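(* Let $(R_0,\mathfrak m_0,k)$ be an F-finite local ring of prime characteristic $p>0$ and let $R$ be a positively graded algebra of finite type over $R_0$. Let $R_{>0}$ be the ideal of $R$ generated by elements of positive degree and $\mathfrak m=\mathfrak m_0+R_{>0}$. Suppose that $M$ is a finitely generated graded $R$-module. Then $a_e(M)=a_e(M_{\mathfrak m})$ for all $e\in\mathbb Z_{>0}$. In particular, $\operatorname{sr}(M)=\operatorname{sr}(M_{\mathfrak m})$ and $r_F(M)=r_F(M_{\mathfrak m})$.
   Context: Rings are commutative, Noetherian, with unity, of prime characteristic $p>0$. Positively graded over $R_0$ means $R=\bigoplus_{n\ge 0}R_n$ with degree-zero part $R_0$. $F^e_*M$ is $M$ viewed as an $R$-module via the $e$-th iterate of Frobenius; a ring is F-finite if its Frobenius is a finite map. $\operatorname{frk}_R(N)$ is the maximal rank of a free module $G$ admitting a surjection $N\to G$. $a_e(M)=\operatorname{frk}_R(F^e_*M)$ and $a_e(M_{\mathfrak m})=\operatorname{frk}_{R_{\mathfrak m}}(F^e_*(M_{\mathfrak m}))$. If $a_e(M)>0$ for some $e>0$, then $\operatorname{sr}(M)=\sup\{\ell\in\mathbb Z_{\ge 0}\mid\liminf_{e\to\infty}a_e(M)/p^{e\ell}>0\}$ and $r_F(M)=\lim_{e\to\infty}a_e(M)/p^{e\operatorname{sr}(M)}$ (the limit exists). If $a_e(M)=0$ for all $e>0$, then $\operatorname{sr}(M)=-1$ and $r_F(M)=0$. The same definitions are used for the $R_{\mathfrak m}$-module $M_{\mathfrak m}$. *)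

theory Defs
  imports
    "HOL-Algebra.Module"
    "HOL-Algebra.Generated_Rings"
    "HOL-Algebra.Ring_Divisibility"
    "HOL-Computational_Algebra.Primes"
    "HOL-Library.Extended_Real"
    "HOL-Library.Liminf_Limsup"
begin

section \<open>Modules\<close>

(* As for every module record of HOL-Algebra, the fields mult and one of the records built
   below carry no meaning when the record is used as a module. *)

definition regular_module :: "('a, 'r) ring_scheme \<Rightarrow> ('a, 'a) module" where
  "regular_module R = \<lparr>carrier = carrier R, monoid.mult = monoid.mult R, monoid.one = \<one>\<^bsub>R\<^esub>,
     ring.zero = \<zero>\<^bsub>R\<^esub>, ring.add = ring.add R, module.smult = monoid.mult R\<rparr>"

definition free_module :: "('a, 'r) ring_scheme \<Rightarrow> nat \<Rightarrow> ('a, nat \<Rightarrow> 'a) module" where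
  "free_module R n = \<lparr>carrier = {..<n} \<rightarrow>\<^sub>E carrier R,
     monoid.mult = (\<lambda>x y. \<lambda>i\<in>{..<n}. x i \<otimes>\<^bsub>R\<^esub> y i), monoid.one = (\<lambda>i\<in>{..<n}. \<one>\<^bsub>R\<^esub>),
     ring.zero = (\<lambda>i\<in>{..<n}. \<zero>\<^bsub>R\<^esub>), ring.add = (\<lambda>x y. \<lambda>i\<in>{..<n}. x i \<oplus>\<^bsub>R\<^esub> y i),
     module.smult = (\<lambda>a x. \<lambda>i\<in>{..<n}. a \<otimes>\<^bsub>R\<^esub> x i)\<rparr>"

definition module_hom ::
    "('a, 'r) ring_scheme \<Rightarrow> ('a, 'b, 'm) module_scheme \<Rightarrow> ('a, 'c, 'n) module_scheme
      \<Rightarrow> ('b \<Rightarrow> 'c) set" where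
  "module_hom R M N = {f \<in> hom (add_monoid M) (add_monoid N).
     \<forall>a\<in>carrier R. \<forall>x\<in>carrier M. f (a \<odot>\<^bsub>M\<^esub> x) = a \<odot>\<^bsub>N\<^esub> f x}"

definition fg_module :: "('a, 'r) ring_scheme \<Rightarrow> ('a, 'b, 'm) module_scheme \<Rightarrow> bool" where
  "fg_module R M \<longleftrightarrow> (\<exists>S. finite S \<and> S \<subseteq> carrier M \<and>
     carrier M = \<Inter> {N. submodule N R M \<and> S \<subseteq> N})"

(* A free module of rank n is isomorphic to free_module R n. If R is nonzero and N is finitely
   generated, only finitely many n occur and the maximum exists. *)
definition frk :: "('a, 'r) ring_scheme \<Rightarrow> ('a, 'b, 'm) module_scheme \<Rightarrow> nat" where
  "frk R N = (GREATEST n. \<exists>f \<in> module_hom R N (free_module R n).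
     f ` carrier N = carrier (free_module R n))"


section \<open>Rings\<close>

definition has_characteristic :: "('a, 'r) ring_scheme \<Rightarrow> nat \<Rightarrow> bool" where
  "has_characteristic R p \<longleftrightarrow> (\<forall>n::nat. [n] \<cdot>\<^bsub>R\<^esub> \<one>\<^bsub>R\<^esub> = \<zero>\<^bsub>R\<^esub> \<longleftrightarrow> p dvd n)"

definition noetherian_local_ring :: "('a, 'r) ring_scheme \<Rightarrow> 'a set \<Rightarrow> bool" where
  "noetherian_local_ring R P \<longleftrightarrow> cring R \<and> noetherian_ring R \<and> maximalideal P R \<and>
     (\<forall>J. maximalideal J R \<longrightarrow> J = P)"

definition finite_type_over :: "('a, 'r) ring_scheme \<Rightarrow> 'a set \<Rightarrow> bool" where
  "finite_type_over R K \<longleftrightarrow>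
     (\<exists>S. finite S \<and> S \<subseteq> carrier R \<and> generate_ring R (K \<union> S) = carrier R)"


section \<open>Gradings\<close>

definition internal_direct_sum :: "('a, 'r) ring_scheme \<Rightarrow> ('i \<Rightarrow> 'a set) \<Rightarrow> bool" where
  "internal_direct_sum M A \<longleftrightarrow> (\<forall>i. subgroup (A i) (add_monoid M)) \<and>
     (\<forall>x\<in>carrier M. \<exists>!f. (\<forall>i. f i \<in> A i) \<and> finite {i. f i \<noteq> \<zero>\<^bsub>M\<^esub>} \<and>
        x = finsum M f {i. f i \<noteq> \<zero>\<^bsub>M\<^esub>})"

definition positively_graded_ring :: "('a, 'r) ring_scheme \<Rightarrow> (nat \<Rightarrow> 'a set) \<Rightarrow> bool" where
  "positively_graded_ring R A \<longleftrightarrow> cring R \<and> internal_direct_sum R A \<and>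
     (\<forall>i j. \<forall>a\<in>A i. \<forall>b\<in>A j. a \<otimes>\<^bsub>R\<^esub> b \<in> A (i + j))"

definition graded_module ::
    "('a, 'r) ring_scheme \<Rightarrow> (nat \<Rightarrow> 'a set) \<Rightarrow> ('a, 'b, 'm) module_scheme
      \<Rightarrow> (int \<Rightarrow> 'b set) \<Rightarrow> bool" where
  "graded_module R A M B \<longleftrightarrow> module R M \<and> internal_direct_sum M B \<and>
     (\<forall>i j. \<forall>a\<in>A i. \<forall>x\<in>B j. a \<odot>\<^bsub>M\<^esub> x \<in> B (int i + j))"

definition positive_part :: "('a, 'r) ring_scheme \<Rightarrow> (nat \<Rightarrow> 'a set) \<Rightarrow> 'a set" where
  "positive_part R A = Idl\<^bsub>R\<^esub> (\<Union>n\<in>{0<..}. A n)"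


section \<open>Localization at a prime ideal\<close>

(* The fraction x/s is the set of all pairs (y, t) equivalent to (x, s); t ranges over the
   complement of P. *)
definition fraction ::
    "('a, 'r) ring_scheme \<Rightarrow> 'a set \<Rightarrow> ('a, 'b, 'm) module_scheme \<Rightarrow> 'b \<Rightarrow> 'a
      \<Rightarrow> ('b \<times> 'a) set" where
  "fraction R P M x s = {(y, t). y \<in> carrier M \<and> t \<in> carrier R - P \<and>
     (\<exists>u\<in>carrier R - P. u \<odot>\<^bsub>M\<^esub> (t \<odot>\<^bsub>M\<^esub> x) = u \<odot>\<^bsub>M\<^esub> (s \<odot>\<^bsub>M\<^esub> y))}"

(* The operations on classes are unions over all representatives: every choice of
   representatives gives the same class. *)
definition localized_module ::
    "('a, 'r) ring_scheme \<Rightarrow> 'a set \<Rightarrow> ('a, 'b, 'm) module_scheme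
      \<Rightarrow> (('a \<times> 'a) set, ('b \<times> 'a) set) module" where
  "localized_module R P M =
    \<lparr>carrier = {fraction R P M x s | x s. x \<in> carrier M \<and> s \<in> carrier R - P},
     monoid.mult = undefined,
     monoid.one = undefined,
     ring.zero = fraction R P M \<zero>\<^bsub>M\<^esub> \<one>\<^bsub>R\<^esub>,
     ring.add = (\<lambda>V W. \<Union>(x, s)\<in>V. \<Union>(y, t)\<in>W.
       fraction R P M ((t \<odot>\<^bsub>M\<^esub> x) \<oplus>\<^bsub>M\<^esub> (s \<odot>\<^bsub>M\<^esub> y)) (s \<otimes>\<^bsub>R\<^esub> t)),
     module.smult = (\<lambda>Q W. \<Union>(a, s)\<in>Q. \<Union>(x, t)\<in>W. fraction R P M (a \<odot>\<^bsub>M\<^esub> x) (s \<otimes>\<^bsub>R\<^esub> t))\<rparr>"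

definition localized_ring :: "('a, 'r) ring_scheme \<Rightarrow> 'a set \<Rightarrow> ('a \<times> 'a) set ring" where
  "localized_ring R P =
    \<lparr>carrier = carrier (localized_module R P (regular_module R)),
     monoid.mult = module.smult (localized_module R P (regular_module R)),
     monoid.one = fraction R P (regular_module R) \<one>\<^bsub>R\<^esub> \<one>\<^bsub>R\<^esub>,
     ring.zero = ring.zero (localized_module R P (regular_module R)),
     ring.add = ring.add (localized_module R P (regular_module R))\<rparr>"


section \<open>Frobenius\<close>

(* The iterated Frobenius pushforward of M: the same additive group, with r acting as
   r ^ (p ^ e). *)
definition frobenius_pushforward ::
    "('a, 'r) ring_scheme \<Rightarrow> nat \<Rightarrow> nat \<Rightarrow> ('a, 'b, 'm) module_scheme
      \<Rightarrow> ('a, 'b, 'm) module_scheme" where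
  "frobenius_pushforward R p e M = M\<lparr>module.smult := (\<lambda>r x. (r [^]\<^bsub>R\<^esub> (p ^ e)) \<odot>\<^bsub>M\<^esub> x)\<rparr>"

definition F_finite :: "('a, 'r) ring_scheme \<Rightarrow> nat \<Rightarrow> bool" where
  "F_finite R p \<longleftrightarrow> fg_module R (frobenius_pushforward R p 1 (regular_module R))"

definition frobenius_frk ::
    "('a, 'r) ring_scheme \<Rightarrow> nat \<Rightarrow> ('a, 'b, 'm) module_scheme \<Rightarrow> nat \<Rightarrow> nat" where
  "frobenius_frk R p M e = frk R (frobenius_pushforward R p e M)"

(* The supremum is taken in the extended reals, where it always exists; ereal also
   accommodates the value -1. *)
definition splitting_dimension ::
    "('a, 'r) ring_scheme \<Rightarrow> nat \<Rightarrow> ('a, 'b, 'm) module_scheme \<Rightarrow> ereal" where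
  "splitting_dimension R p M =
    (if \<exists>e>0. frobenius_frk R p M e > 0
     then SUP l \<in> {l::nat. liminf (\<lambda>e. ereal (real (frobenius_frk R p M e) / real p ^ (e * l))) > 0}.
            ereal (real l)
     else -1)"

(* The exponent is real, hence powr; lim is only meaningful when the sequence converges. *)
definition F_splitting_ratio ::
    "('a, 'r) ring_scheme \<Rightarrow> nat \<Rightarrow> ('a, 'b, 'm) module_scheme \<Rightarrow> real" where
  "F_splitting_ratio R p M =
    (if \<exists>e>0. frobenius_frk R p M e > 0
     then lim (\<lambda>e. real (frobenius_frk R p M e) /
                 real p powr (real e * real_of_ereal (splitting_dimension R p M)))
     else 0)"

end

theory Submission
  imports Defs
begin

text \<open>
  Write q = p^e. For every e and n it is shown that the pushforward of M along the e-th Frobenius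
  maps onto a free R-module of rank n if and only if the pushforward of the localization of M maps
  onto a free module of rank n over the localization of R. Hence the two Frobenius free ranks agree
  for all e, and the splitting dimension and the F-splitting ratio agree because they are computed
  from these sequences.

  A surjection f over R localizes: in the pushforward, x/s is the multiple by 1/s of s^(q-1) x, so
  x/s has to be sent to f(s^(q-1) x)/s (\<open>frobenius_surjection_localizes\<close>).

  For the converse the grading enters. An element s of R lies outside \<open>\<mm>\<close> exactly if its
  degree-zero component lies outside \<open>\<mm>\<^sub>0\<close>, that is, is a unit. Such an s is
  invertible in the product of all homogeneous pieces of R, just as a power series with invertible
  constant term, and so a fraction a/s has a well-defined coefficient in each degree
  (\<open>expansion\<close>). A surjection onto a free module over the localization therefore gives n
  linear maps from the pushforward of M to that product, together with elements of M on which they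
  are diagonal, with values outside \<open>\<mm>\<^sub>0\<close> on the diagonal in degree zero.

  From these one builds, one at a time, linear maps f_k from the pushforward to R and homogeneous
  elements y_k of M with f_k(y_l) = 1 for k = l and 0 otherwise. As long as fewer than n of them
  have been found, a dimension count modulo \<open>\<mm>\<close> produces an element X on which all f_k
  already found take values in \<open>\<mm>\<close>, while one of the n given maps does not vanish on X
  modulo \<open>\<mm>\<^sub>0\<close> in degree zero. Composed with the projection that kills the y_k, this
  map is still nonzero on X modulo \<open>\<mm>\<^sub>0\<close>, hence on some homogeneous component z of X; there
  its degree-zero coefficient is a unit. Keeping only the part of the map that is homogeneous and
  of degree zero on z turns it into a map to R itself, since only finitely many coefficients
  survive (\<open>functional_of_formal\<close>, \<open>dual_system_extend\<close>). The n maps so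
  obtained are the coordinates of a surjection onto a free R-module of rank n.
\<close>

section \<open>Graded abelian groups\<close>

lemma (in abelian_monoid) finsum_in_submonoid:
  assumes "\<zero> \<in> H" "H \<subseteq> carrier G" "\<And>x y. x \<in> H \<Longrightarrow> y \<in> H \<Longrightarrow> x \<oplus> y \<in> H"
    and "\<And>i. i \<in> I \<Longrightarrow> f i \<in> H"
  shows "finsum G f I \<in> H"
  using assms(4)
proof (induction I rule: infinite_finite_induct)
  case (infinite I)
  then show ?case using assms(1) by simp
next
  case empty
  then show ?case using assms(1) by simp
next
  case (insert i I)
  moreover have "f \<in> I \<rightarrow> carrier G" "f i \<in> carrier G" using insert.prems assms(2) by auto
  ultimately show ?case using assms(3) by (simp add: finsum_insert)
qed

lemma (in abelian_monoid) finsum_support_superset: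
  assumes "finite I" "\<And>i. i \<in> I \<Longrightarrow> f i \<in> carrier G" "\<And>i. i \<notin> I \<Longrightarrow> f i = \<zero>"
  shows "finsum G f {i. f i \<noteq> \<zero>} = finsum G f I"
proof -
  have "{i. f i \<noteq> \<zero>} \<subseteq> I" using assms(3) by blast
  then show ?thesis
    using assms(1,2) by (intro add.finprod_mono_neutral_cong_left) auto
qed

lemma (in abelian_monoid) finsum_hom:
  assumes "abelian_monoid H" "h \<in> hom (add_monoid G) (add_monoid H)" "h \<zero> = \<zero>\<^bsub>H\<^esub>"
    and "f \<in> I \<rightarrow> carrier G"
  shows "h (finsum G f I) = finsum H (\<lambda>i. h (f i)) I"
proof -
  interpret H: abelian_monoid H by fact
  have cl: "h x \<in> carrier H" if "x \<in> carrier G" for x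
    using assms(2) that by (auto simp: hom_def)
  have add: "h (x \<oplus> y) = h x \<oplus>\<^bsub>H\<^esub> h y" if "x \<in> carrier G" "y \<in> carrier G" for x y
    using assms(2) that by (auto simp: hom_def)
  show ?thesis using assms(4)
  proof (induction I rule: infinite_finite_induct)
    case (insert i I)
    then show ?case using cl add by (simp add: finsum_insert H.finsum_insert Pi_def)
  qed (use assms(3) in auto)
qed


definition component :: "('a, 'r) ring_scheme \<Rightarrow> ('i \<Rightarrow> 'a set) \<Rightarrow> 'a \<Rightarrow> 'i \<Rightarrow> 'a" where
  "component G A x = (THE f. (\<forall>i. f i \<in> A i) \<and> finite {i. f i \<noteq> \<zero>\<^bsub>G\<^esub>} \<and>
        x = finsum G f {i. f i \<noteq> \<zero>\<^bsub>G\<^esub>})"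

locale graded_group = abelian_group G for G :: "('a, 'r) ring_scheme" (structure) +
  fixes A :: "'i \<Rightarrow> 'a set"
  assumes direct_sum: "internal_direct_sum G A"
begin

abbreviation comp where "comp \<equiv> component G A"

lemma piece_subgroup: "subgroup (A i) (add_monoid G)"
  using direct_sum by (simp add: internal_direct_sum_def)

lemma piece_closed: "x \<in> A i \<Longrightarrow> x \<in> carrier G"
  using subgroup.subset[OF piece_subgroup] by auto

lemma piece_zero: "\<zero> \<in> A i"
  using subgroup.one_closed[OF piece_subgroup] by auto

lemma piece_add: "x \<in> A i \<Longrightarrow> y \<in> A i \<Longrightarrow> x \<oplus> y \<in> A i"
  using subgroup.m_closed[OF piece_subgroup] by auto

lemma piece_neg: "x \<in> A i \<Longrightarrow> \<ominus> x \<in> A i"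
  using subgroup.m_inv_closed[OF piece_subgroup] by (auto simp: a_inv_def)

lemma component_spec:
  assumes "x \<in> carrier G"
  shows "(\<forall>i. comp x i \<in> A i) \<and> finite {i. comp x i \<noteq> \<zero>} \<and> x = finsum G (comp x) {i. comp x i \<noteq> \<zero>}"
proof -
  have "\<exists>!f. (\<forall>i. f i \<in> A i) \<and> finite {i. f i \<noteq> \<zero>} \<and> x = finsum G f {i. f i \<noteq> \<zero>}"
    using direct_sum assms by (simp add: internal_direct_sum_def)
  from theI'[OF this] show ?thesis by (simp add: component_def)
qed

lemma component_in: "x \<in> carrier G \<Longrightarrow> comp x i \<in> A i"
  using component_spec by blast

lemma component_closed [simp]: "x \<in> carrier G \<Longrightarrow> comp x i \<in> carrier G"
  using component_in piece_closed by blast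

lemma finite_support: "x \<in> carrier G \<Longrightarrow> finite {i. comp x i \<noteq> \<zero>}"
  using component_spec by blast

lemma component_sum:
  assumes "x \<in> carrier G" "finite I" "\<And>i. i \<notin> I \<Longrightarrow> comp x i = \<zero>"
  shows "x = finsum G (comp x) I"
proof -
  have "x = finsum G (comp x) {i. comp x i \<noteq> \<zero>}"
    using component_spec[OF assms(1)] by blast
  also have "\<dots> = finsum G (comp x) I"
    using assms by (intro finsum_support_superset) auto
  finally show ?thesis .
qed

lemma component_unique:
  assumes "finite I" "\<And>i. f i \<in> A i" "\<And>i. i \<notin> I \<Longrightarrow> f i = \<zero>"
  shows "comp (finsum G f I) = f"
proof -
  let ?x = "finsum G f I"
  have cl: "?x \<in> carrier G" using assms(2) piece_closed by (intro finsum_closed) blast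
  have sub: "{i. f i \<noteq> \<zero>} \<subseteq> I" using assms(3) by blast
  have "?x = finsum G f {i. f i \<noteq> \<zero>}"
    using assms piece_closed by (intro finsum_support_superset[symmetric]) auto
  moreover have "finite {i. f i \<noteq> \<zero>}" using sub assms(1) finite_subset by blast
  moreover have "\<exists>!f. (\<forall>i. f i \<in> A i) \<and> finite {i. f i \<noteq> \<zero>} \<and> ?x = finsum G f {i. f i \<noteq> \<zero>}"
    using direct_sum cl by (simp add: internal_direct_sum_def)
  ultimately show ?thesis
    unfolding component_def using assms(2) by (intro the1_equality) auto
qed

lemma component_add:
  assumes "x \<in> carrier G" "y \<in> carrier G"
  shows "comp (x \<oplus> y) i = comp x i \<oplus> comp y i"
proof -
  let ?I = "{i. comp x i \<noteq> \<zero>} \<union> {i. comp y i \<noteq> \<zero>}"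
  let ?f = "\<lambda>i. comp x i \<oplus> comp y i"
  have fin: "finite ?I" using finite_support assms by blast
  have "x = finsum G (comp x) ?I" "y = finsum G (comp y) ?I"
    using component_sum assms fin by blast+
  then have "x \<oplus> y = finsum G (comp x) ?I \<oplus> finsum G (comp y) ?I" by simp
  also have "\<dots> = finsum G ?f ?I"
    using assms by (intro finsum_addf[symmetric]) auto
  finally have eq: "x \<oplus> y = finsum G ?f ?I" .
  have "comp (finsum G ?f ?I) = ?f"
    using assms by (intro component_unique fin) (auto intro: piece_add component_in)
  then show ?thesis using eq by metis
qed

lemma component_homogeneous:
  assumes "x \<in> A j"
  shows "comp x i = (if i = j then x else \<zero>)"
proof -
  let ?f = "\<lambda>i. if i = j then x else \<zero>"
  have "finsum G ?f {j} = x" using assms piece_closed by (simp add: finsum_insert)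
  moreover have "comp (finsum G ?f {j}) = ?f"
    using assms piece_zero by (intro component_unique) auto
  ultimately show ?thesis by metis
qed

lemma component_zero [simp]: "comp \<zero> i = \<zero>"
  using component_homogeneous[OF piece_zero, of i i] by simp

lemma component_neg:
  assumes "x \<in> carrier G"
  shows "comp (\<ominus> x) i = \<ominus> comp x i"
proof -
  have "comp (\<ominus> x) i \<oplus> comp x i = \<zero>"
    using assms component_add[of "\<ominus> x" x i] by (simp add: l_neg)
  then show ?thesis using assms by (metis a_inv_closed component_closed minus_equality)
qed

lemma component_diff:
  assumes "x \<in> carrier G" "y \<in> carrier G"
  shows "comp (x \<ominus> y) i = comp x i \<ominus> comp y i"
  using assms by (simp add: a_minus_def component_add component_neg)

lemma component_ext:
  assumes "x \<in> carrier G" "y \<in> carrier G" "\<And>i. comp x i = comp y i"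
  shows "x = y"
  by (metis assms component_spec ext)

lemma homogeneous_induct [consumes 1, case_names zero homogeneous add]:
  assumes "x \<in> carrier G" "P \<zero>" "\<And>i y. y \<in> A i \<Longrightarrow> P y"
    and "\<And>y z. y \<in> carrier G \<Longrightarrow> z \<in> carrier G \<Longrightarrow> P y \<Longrightarrow> P z \<Longrightarrow> P (y \<oplus> z)"
  shows "P x"
proof -
  let ?H = "{x \<in> carrier G. P x}"
  have "finsum G (comp x) {i. comp x i \<noteq> \<zero>} \<in> ?H"
    using assms by (intro finsum_in_submonoid) (auto intro: component_in)
  then show ?thesis using component_spec[OF assms(1)] by simp
qed

lemma exists_component_outside:
  assumes "x \<in> carrier G" "\<not> P x" "P \<zero>"
    and "\<And>y z. y \<in> carrier G \<Longrightarrow> z \<in> carrier G \<Longrightarrow> P y \<Longrightarrow> P z \<Longrightarrow> P (y \<oplus> z)"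
  shows "\<exists>i. \<not> P (comp x i)"
proof (rule ccontr)
  assume "\<not> ?thesis"
  then have "finsum G (comp x) {i. comp x i \<noteq> \<zero>} \<in> {x \<in> carrier G. P x}"
    using assms by (intro finsum_in_submonoid) auto
  then show False using component_spec[OF assms(1)] assms(2) by simp
qed

end

section \<open>Commutative rings: maximal ideals, Frobenius, linear algebra modulo a prime\<close>

text \<open>Zorn's lemma applies because in a Noetherian ring a nonempty chain of ideals contains its
  union, which is then proper along with the members of the chain.\<close>

lemma noetherian_exists_maximalideal:
  assumes "noetherian_ring R" "ideal I R" "I \<noteq> carrier R"
  shows "\<exists>J. maximalideal J R \<and> I \<subseteq> J"
proof -
  interpret noetherian_ring R by fact
  let ?F = "{J. ideal J R \<and> I \<subseteq> J \<and> J \<noteq> carrier R}"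
  have "\<exists>J\<in>?F. \<forall>X\<in>?F. J \<subseteq> X \<longrightarrow> X = J"
  proof (rule subset_Zorn_nonempty)
    show "?F \<noteq> {}" using assms by blast
    fix C assume C: "C \<noteq> {}" "subset.chain ?F C"
    then have "subset.chain {I. ideal I R} C"
      unfolding subset.chain_def by blast
    then have "\<Union>C \<in> C" using ideal_chain_is_trivial C(1) by blast
    then show "\<Union>C \<in> ?F" using C(2) unfolding subset.chain_def by blast
  qed
  then obtain J where J: "ideal J R" "I \<subseteq> J" "J \<noteq> carrier R"
    and max: "\<forall>X\<in>?F. J \<subseteq> X \<longrightarrow> X = J" by auto
  have "maximalideal J R"
  proof (rule maximalidealI)
    show "ideal J R" by fact
    show "carrier R \<noteq> J" using J(3) by simp
    fix K assume "ideal K R" "J \<subseteq> K"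
    then show "K = J \<or> K = carrier R" using max J(2) by auto
  qed
  with J show ?thesis by blast
qed

text \<open>A nonunit generates a proper ideal, and the only maximal ideal that can contain it is P.\<close>

lemma noetherian_local_ring_unit:
  fixes S (structure)
  assumes "noetherian_local_ring S P" "a \<in> carrier S" "a \<notin> P"
  shows "a \<in> Units S"
proof (rule ccontr)
  assume nonunit: "a \<notin> Units S"
  interpret cring S using assms(1) by (simp add: noetherian_local_ring_def)
  have "PIdl a \<noteq> carrier S"
  proof
    assume "PIdl a = carrier S"
    then have "\<one> \<in> PIdl a" by simp
    then obtain b where "b \<in> carrier S" "\<one> = b \<otimes> a"
      unfolding cgenideal_def by blast
    then have "a \<in> Units S"
      using assms(2) m_comm[of b a] unfolding Units_def by force
    then show False using nonunit by simp
  qed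
  then obtain J where J: "maximalideal J S" "PIdl a \<subseteq> J"
    using noetherian_exists_maximalideal[OF _ cgenideal_ideal[OF assms(2)]] assms(1)
    unfolding noetherian_local_ring_def by blast
  have "\<forall>J. maximalideal J S \<longrightarrow> J = P"
    using assms(1) by (simp add: noetherian_local_ring_def)
  then show False
    using J cgenideal_self[OF assms(2)] assms(3) by blast
qed

lemma (in cring) binomial_expansion:
  assumes a [simp]: "a \<in> carrier R" and b [simp]: "b \<in> carrier R"
  shows "(a \<oplus> b) [^] n = (\<Oplus>k\<in>{..n}. [(n choose k)] \<cdot>\<^bsub>R\<^esub> (a [^] k \<otimes> b [^] (n - k)))"
proof (induction n)
  case 0
  show ?case by (simp add: Pi_def)
next
  case (Suc n)
  let ?t = "\<lambda>k. [(n choose k)] \<cdot>\<^bsub>R\<^esub> (a [^] k \<otimes> b [^] (n - k))"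
  let ?u = "\<lambda>k. [(n choose k)] \<cdot>\<^bsub>R\<^esub> (a [^] k \<otimes> b [^] (Suc n - k))"
  let ?v = "\<lambda>k. [(n choose k)] \<cdot>\<^bsub>R\<^esub> (a [^] Suc k \<otimes> b [^] (n - k))"
  let ?w = "\<lambda>k. [(n choose Suc k)] \<cdot>\<^bsub>R\<^esub> (a [^] Suc k \<otimes> b [^] (n - k))"
  let ?x = "\<lambda>k. [(Suc n choose k)] \<cdot>\<^bsub>R\<^esub> (a [^] k \<otimes> b [^] (Suc n - k))"
  have shift: "?t k \<otimes> a = ?v k" for k
    by (subst add_pow_ldistr) (auto simp: m_ac)
  have "(\<Oplus>k\<in>{..n}. ?t k) \<otimes> a = (\<Oplus>k\<in>{..n}. ?t k \<otimes> a)"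
    by (rule finsum_ldistr) auto
  also have "\<dots> = (\<Oplus>k\<in>{..n}. ?v k)"
    by (rule finsum_cong') (auto simp: shift simp del: nat_pow_Suc)
  finally have A: "(\<Oplus>k\<in>{..n}. ?t k) \<otimes> a = (\<Oplus>k\<in>{..n}. ?v k)" .
  have "(\<Oplus>k\<in>{..n}. ?t k) \<otimes> b = (\<Oplus>k\<in>{..n}. ?t k \<otimes> b)"
    by (rule finsum_ldistr) auto
  also have "\<dots> = (\<Oplus>k\<in>{..n}. ?u k)"
    by (rule finsum_cong') (auto simp: add_pow_ldistr m_assoc Suc_diff_le)
  also have "\<dots> = (\<Oplus>k\<in>{..Suc n}. ?u k)"
    by (subst finsum_Suc) (auto simp: binomial_eq_0)
  also have "\<dots> = (\<Oplus>k\<in>{..n}. ?u (Suc k)) \<oplus> ?u 0"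
    by (rule finsum_Suc2) auto
  also have "\<dots> = (\<Oplus>k\<in>{..n}. ?w k) \<oplus> b [^] Suc n"
    by (simp del: nat_pow_Suc)
  finally have B: "(\<Oplus>k\<in>{..n}. ?t k) \<otimes> b = (\<Oplus>k\<in>{..n}. ?w k) \<oplus> b [^] Suc n" .
  have "(a \<oplus> b) [^] Suc n = (\<Oplus>k\<in>{..n}. ?t k) \<otimes> a \<oplus> (\<Oplus>k\<in>{..n}. ?t k) \<otimes> b"
    by (simp add: Suc r_distr)
  also have "\<dots> = ((\<Oplus>k\<in>{..n}. ?v k) \<oplus> (\<Oplus>k\<in>{..n}. ?w k)) \<oplus> b [^] Suc n"
    unfolding A B by (simp add: a_assoc del: nat_pow_Suc)
  also have "(\<Oplus>k\<in>{..n}. ?v k) \<oplus> (\<Oplus>k\<in>{..n}. ?w k) = (\<Oplus>k\<in>{..n}. ?v k \<oplus> ?w k)"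
    by (rule finsum_addf[symmetric]) auto
  also have "\<dots> = (\<Oplus>k\<in>{..n}. ?x (Suc k))"
    by (rule finsum_cong') (auto simp: add.nat_pow_mult)
  also have "\<dots> \<oplus> b [^] Suc n = (\<Oplus>k\<in>{..n}. ?x (Suc k)) \<oplus> ?x 0"
    by (simp del: nat_pow_Suc binomial_Suc_Suc)
  also have "\<dots> = (\<Oplus>k\<in>{..Suc n}. ?x k)"
    by (rule finsum_Suc2[symmetric]) auto
  finally show ?case .
qed

text \<open>In the binomial expansion of a p-th power, p divides every coefficient but the first and the
  last.\<close>

lemma (in cring) prime_power_add:
  assumes p: "Factorial_Ring.prime (p::nat)" "[p] \<cdot>\<^bsub>R\<^esub> \<one> = \<zero>"
    and a [simp]: "a \<in> carrier R" and b [simp]: "b \<in> carrier R"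
  shows "(a \<oplus> b) [^] p = a [^] p \<oplus> b [^] p"
proof -
  have kill: "[m] \<cdot>\<^bsub>R\<^esub> x = \<zero>" if "p dvd m" "x \<in> carrier R" for m x
  proof -
    obtain l where l: "m = p * l" using \<open>p dvd m\<close> by blast
    have "[p] \<cdot>\<^bsub>R\<^esub> x = ([p] \<cdot>\<^bsub>R\<^esub> \<one>) \<otimes> x" using that by (simp add: add_pow_ldistr)
    then have "[p] \<cdot>\<^bsub>R\<^esub> x = \<zero>" using p(2) that by simp
    then show ?thesis using that l by (metis add.nat_pow_one add.nat_pow_pow)
  qed
  obtain r where r: "p = Suc r" using prime_gt_0_nat[OF p(1)] gr0_implies_Suc by blast
  let ?t = "\<lambda>k. [(p choose k)] \<cdot>\<^bsub>R\<^esub> (a [^] k \<otimes> b [^] (p - k))"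
  have "(a \<oplus> b) [^] p = (\<Oplus>k\<in>{..Suc r}. ?t k)"
    using binomial_expansion[OF a b, of p] unfolding r .
  also have "\<dots> = ?t (Suc r) \<oplus> (\<Oplus>k\<in>{..r}. ?t k)"
    by (rule finsum_Suc) auto
  also have "?t (Suc r) = a [^] p" using r by simp
  also have "(\<Oplus>k\<in>{..r}. ?t k) = (\<Oplus>k\<in>{..r}. if 0 = k then b [^] p else \<zero>)"
    using r p(1) by (intro finsum_cong') (auto intro!: kill dvd_choose_prime)
  also have "\<dots> = b [^] p"
    using finsum_singleton[of 0 "{..r}" "\<lambda>_. b [^] p"] by simp
  finally show ?thesis .
qed

lemma (in cring) frobenius_power_add:
  assumes p: "Factorial_Ring.prime (p::nat)" "[p] \<cdot>\<^bsub>R\<^esub> \<one> = \<zero>"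
    and "a \<in> carrier R" "b \<in> carrier R"
  shows "(a \<oplus> b) [^] (p ^ e) = a [^] (p ^ e) \<oplus> b [^] (p ^ e)"
proof (induction e)
  case (Suc e)
  have "x [^] (p ^ Suc e) = (x [^] (p ^ e)) [^] p" if "x \<in> carrier R" for x
    using that by (simp add: nat_pow_pow mult.commute)
  then show ?case using Suc assms prime_power_add[OF p] by simp
qed (use assms in simp)

text \<open>A homogeneous linear system over the domain R/P with fewer equations than unknowns has a
  nontrivial solution. The elimination is carried out in R without division: a coefficient outside
  P serves as pivot, the other equations are multiplied by it before the pivot unknown is
  eliminated, and primality keeps the solution nontrivial when it is multiplied by the pivot.\<close>

lemma (in cring) prime_ideal_kernel_vector:
  fixes K :: "'k set" and J :: "'j set"
  assumes P: "primeideal P R"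
    and fin: "finite K" "finite J" and card: "card K < card J"
    and b: "\<And>k j. k \<in> K \<Longrightarrow> j \<in> J \<Longrightarrow> b k j \<in> carrier R"
  shows "\<exists>c. (\<forall>j\<in>J. c j \<in> carrier R) \<and> (\<exists>j\<in>J. c j \<notin> P) \<and>
    (\<forall>k\<in>K. (\<Oplus>j\<in>J. c j \<otimes> b k j) \<in> P)"
  using fin card b
proof (induction K arbitrary: J b rule: finite_induct)
  interpret P: primeideal P R by (rule P)
  { case empty
    then have "J \<noteq> {}" by auto
    moreover have "\<one> \<notin> P" using P.one_imp_carrier P.I_notcarr by auto
    ultimately show ?case by (intro exI[of _ "\<lambda>_. \<one>"]) auto }
  case (insert k K)
  have in_P: "(\<Oplus>j\<in>I. f j) \<in> P" if "\<And>j. j \<in> I \<Longrightarrow> f j \<in> P" for I :: "'j set" and f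
    using that P.zero_closed P.a_subset P.a_closed by (intro finsum_in_submonoid) auto
  show ?case
  proof (cases "\<forall>j\<in>J. b k j \<in> P")
    case True
    have "card K < card J" using insert.hyps insert.prems(2) by simp
    then obtain c where c: "\<forall>j\<in>J. c j \<in> carrier R" "\<exists>j\<in>J. c j \<notin> P"
      "\<forall>k\<in>K. (\<Oplus>j\<in>J. c j \<otimes> b k j) \<in> P"
      using insert.IH[of J b] insert.prems by auto
    have "(\<Oplus>j\<in>J. c j \<otimes> b k j) \<in> P"
      using True c(1) P.I_l_closed by (intro in_P) auto
    then show ?thesis using c by (intro exI[of _ c]) auto
  next
    case False
    then obtain j0 where j0: "j0 \<in> J" "b k j0 \<notin> P" by blast
    define d where "d = b k j0"
    define J' where "J' = J - {j0}"
    define b' where "b' l j = d \<otimes> b l j \<ominus> b l j0 \<otimes> b k j" for l j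
    have J: "J = insert j0 J'" "j0 \<notin> J'" "finite J'" using j0 insert.prems by (auto simp: J'_def)
    have bl: "b l j \<in> carrier R" if "l \<in> insert k K" "j \<in> J" for l j using insert.prems that by blast
    have d: "d \<in> carrier R" "d \<notin> P" using bl j0 by (auto simp: d_def)
    have "card K < card J'" using insert.hyps insert.prems(2) J by simp
    moreover have "b' l j \<in> carrier R" if "l \<in> K" "j \<in> J'" for l j
      using bl that d J by (auto simp: b'_def)
    ultimately obtain c where c: "\<forall>j\<in>J'. c j \<in> carrier R" "\<exists>j\<in>J'. c j \<notin> P"
      "\<forall>l\<in>K. (\<Oplus>j\<in>J'. c j \<otimes> b' l j) \<in> P"
      using insert.IH[of J' b'] J(3) by blast
    define s where "s = (\<Oplus>j\<in>J'. c j \<otimes> b k j)"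
    have s: "s \<in> carrier R" using c bl J by (auto simp: s_def intro!: finsum_closed)
    define c' where "c' j = (if j = j0 then \<ominus> s else d \<otimes> c j)" for j
    have c': "c' j \<in> carrier R" if "j \<in> J" for j using that c d s J by (auto simp: c'_def)
    have row: "(\<Oplus>j\<in>J. c' j \<otimes> b l j) = (\<Oplus>j\<in>J'. c j \<otimes> b' l j)" if l: "l \<in> insert k K" for l
    proof -
      have b0: "b l j0 \<in> carrier R" using bl l j0 by blast
      have cl: "c j \<in> carrier R" "b l j \<in> carrier R" "b k j \<in> carrier R" if "j \<in> J'" for j
        using c bl l J that by auto
      have "(\<Oplus>j\<in>J. c' j \<otimes> b l j) = (\<ominus> s) \<otimes> b l j0 \<oplus> (\<Oplus>j\<in>J'. c' j \<otimes> b l j)"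
        unfolding J(1) using J c' bl l s b0 by (subst finsum_insert) (auto simp: c'_def)
      also have "(\<Oplus>j\<in>J'. c' j \<otimes> b l j) = (\<Oplus>j\<in>J'. d \<otimes> (c j \<otimes> b l j))"
        using J cl d by (intro finsum_cong') (auto simp: c'_def m_assoc)
      also have "(\<ominus> s) \<otimes> b l j0 = s \<otimes> (\<ominus> b l j0)" using s b0 by (simp add: l_minus r_minus)
      also have "\<dots> = (\<Oplus>j\<in>J'. (c j \<otimes> b k j) \<otimes> (\<ominus> b l j0))"
        unfolding s_def using cl b0 J(3) by (intro finsum_ldistr) auto
      also have "\<dots> \<oplus> (\<Oplus>j\<in>J'. d \<otimes> (c j \<otimes> b l j))
          = (\<Oplus>j\<in>J'. (c j \<otimes> b k j) \<otimes> (\<ominus> b l j0) \<oplus> d \<otimes> (c j \<otimes> b l j))"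
        using cl b0 d by (intro finsum_addf[symmetric]) auto
      also have "\<dots> = (\<Oplus>j\<in>J'. c j \<otimes> b' l j)"
      proof (rule finsum_cong')
        fix j assume j: "j \<in> J'"
        note cl = cl[OF j]
        have "(c j \<otimes> b k j) \<otimes> (\<ominus> b l j0) = \<ominus> (c j \<otimes> (b l j0 \<otimes> b k j))"
          using cl b0 by (simp add: r_minus m_ac)
        moreover have "d \<otimes> (c j \<otimes> b l j) = c j \<otimes> (d \<otimes> b l j)"
          using cl d by (simp add: m_ac)
        moreover have "c j \<otimes> b' l j = c j \<otimes> (d \<otimes> b l j) \<oplus> \<ominus> (c j \<otimes> (b l j0 \<otimes> b k j))"
          using cl d b0 by (simp add: b'_def a_minus_def r_distr r_minus)
        ultimately show "(c j \<otimes> b k j) \<otimes> (\<ominus> b l j0) \<oplus> d \<otimes> (c j \<otimes> b l j) = c j \<otimes> b' l j"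
          using cl d b0 a_comm by simp
      qed (use cl d b0 in \<open>auto simp: b'_def\<close>)
      finally show ?thesis .
    qed
    have "(\<Oplus>j\<in>J'. c j \<otimes> b' k j) = \<zero>"
    proof (rule add.finprod_one_eqI)
      fix j assume "j \<in> J'"
      then show "c j \<otimes> b' k j = \<zero>"
        using c bl[of k j] bl[of k j0] j0 J by (auto simp: b'_def d_def a_minus_def r_neg)
    qed
    then have "\<forall>l\<in>insert k K. (\<Oplus>j\<in>J. c' j \<otimes> b l j) \<in> P"
      using row c(3) P.zero_closed by auto
    moreover have "\<exists>j\<in>J. c' j \<notin> P"
    proof -
      obtain j where j: "j \<in> J'" "c j \<notin> P" using c(2) by blast
      then have "d \<otimes> c j \<notin> P" using P.I_prime d c(1) by blast
      then show ?thesis using j J by (auto simp: c'_def intro!: bexI[of _ j])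
    qed
    ultimately show ?thesis using c' by blast
  qed
qed

section \<open>Graded rings with local degree-zero part\<close>

locale graded_ring = cring R for R :: "('a, 'r) ring_scheme" (structure) +
  fixes A :: "nat \<Rightarrow> 'a set"
  assumes ring_direct_sum: "internal_direct_sum R A"
    and piece_mult: "a \<in> A i \<Longrightarrow> b \<in> A j \<Longrightarrow> a \<otimes> b \<in> A (i + j)"

sublocale graded_ring \<subseteq> graded_group R A
  by unfold_locales (rule ring_direct_sum)

context graded_ring
begin

text \<open>Both sides are additive in a and in b, so the formula need only be checked on homogeneous
  elements, where a single summand can be nonzero.\<close>

lemma component_mult:
  assumes "a \<in> carrier R" "b \<in> carrier R"
  shows "comp (a \<otimes> b) n = (\<Oplus>i\<in>{..n}. comp a i \<otimes> comp b (n - i))"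
  using assms(1)
proof (induction rule: homogeneous_induct)
  case zero
  show ?case using assms(2) by (simp add: Pi_def finsum_zero)
next
  case (homogeneous j a)
  then have a: "a \<in> A j" "a \<in> carrier R" using piece_closed by auto
  show ?case using assms(2)
  proof (induction rule: homogeneous_induct)
    case zero
    show ?case using a by (simp add: finsum_zero)
  next
    case (homogeneous k b)
    then have b: "b \<in> carrier R" using piece_closed by auto
    have "(\<Oplus>i\<in>{..n}. comp a i \<otimes> comp b (n - i)) = (\<Oplus>i\<in>{..n}. if j = i then a \<otimes> comp b (n - j) else \<zero>)"
      using a b by (intro finsum_cong') (auto simp: component_homogeneous[OF a(1)])
    also have "\<dots> = (if j \<le> n then a \<otimes> comp b (n - j) else \<zero>)"
      using a b by (auto intro!: finsum_singleton add.finprod_one_eqI)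
    also have "\<dots> = comp (a \<otimes> b) n"
      using a b by (auto simp: component_homogeneous[OF piece_mult[OF a(1) homogeneous]]
          component_homogeneous[OF homogeneous])
    finally show ?case by simp
  next
    case (add b c)
    then show ?case using a
      by (simp add: r_distr component_add finsum_addf)
  qed
next
  case (add y z)
  then show ?case using assms(2) by (simp add: l_distr component_add finsum_addf)
qed

lemma component_homogeneous_mult:
  assumes "a \<in> A j" "b \<in> carrier R"
  shows "comp (a \<otimes> b) n = (if j \<le> n then a \<otimes> comp b (n - j) else \<zero>)"
proof -
  have a: "a \<in> carrier R" using assms piece_closed by auto
  have "comp (a \<otimes> b) n = (\<Oplus>i\<in>{..n}. comp a i \<otimes> comp b (n - i))"
    using component_mult a assms by blast
  also have "\<dots> = (\<Oplus>i\<in>{..n}. if j = i then a \<otimes> comp b (n - j) else \<zero>)"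
    using a assms by (intro finsum_cong') (auto simp: component_homogeneous[OF assms(1)])
  also have "\<dots> = (if j \<le> n then a \<otimes> comp b (n - j) else \<zero>)"
    using a assms by (auto intro!: finsum_singleton add.finprod_one_eqI)
  finally show ?thesis .
qed

lemma component_0_mult:
  assumes "a \<in> carrier R" "b \<in> carrier R"
  shows "comp (a \<otimes> b) 0 = comp a 0 \<otimes> comp b 0"
  using component_mult[OF assms, of 0] assms by simp

text \<open>Congruence modulo the elements whose components all have degree at least n, for which
  multiplication is compatible by the product formula.\<close>

definition agree :: "nat \<Rightarrow> 'a \<Rightarrow> 'a \<Rightarrow> bool" where
  "agree n a b \<longleftrightarrow> a \<in> carrier R \<and> b \<in> carrier R \<and> (\<forall>i<n. comp a i = comp b i)"

lemma agree_refl: "a \<in> carrier R \<Longrightarrow> agree n a a"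
  by (simp add: agree_def)

lemma agree_sym: "agree n a b \<Longrightarrow> agree n b a"
  by (simp add: agree_def)

lemma agree_trans [trans]: "agree n a b \<Longrightarrow> agree n b c \<Longrightarrow> agree n a c"
  by (simp add: agree_def)

lemma agree_component: "agree n a b \<Longrightarrow> i < n \<Longrightarrow> comp a i = comp b i"
  by (simp add: agree_def)

lemma agree_add: "agree n a b \<Longrightarrow> agree n c d \<Longrightarrow> agree n (a \<oplus> c) (b \<oplus> d)"
  by (simp add: agree_def component_add)

lemma agree_mult:
  assumes "agree n a b" "agree n c d"
  shows "agree n (a \<otimes> c) (b \<otimes> d)"
proof -
  have cl: "a \<in> carrier R" "b \<in> carrier R" "c \<in> carrier R" "d \<in> carrier R"
    using assms by (auto simp: agree_def)
  have "comp (a \<otimes> c) i = comp (b \<otimes> d) i" if "i < n" for i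
    unfolding component_mult[OF cl(1,3)] component_mult[OF cl(2,4)]
    using assms that cl by (intro finsum_cong') (auto simp: agree_def)
  then show ?thesis using cl by (simp add: agree_def)
qed

end


locale graded_local_ring = graded_ring R A for R :: "('a, 'r) ring_scheme" (structure) and A +
  fixes m0 :: "'a set"
  assumes local_piece: "noetherian_local_ring (R\<lparr>carrier := A 0\<rparr>) m0"
begin

lemma one_in_piece: "\<one> \<in> A 0"
proof -
  interpret R0: cring "R\<lparr>carrier := A 0\<rparr>"
    using local_piece by (simp add: noetherian_local_ring_def)
  show ?thesis using R0.one_closed by simp
qed

lemma m0_prime: "primeideal m0 (R\<lparr>carrier := A 0\<rparr>)"
  using local_piece cring.maximalideal_prime unfolding noetherian_local_ring_def by blast

lemma m0_subset: "m0 \<subseteq> A 0"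
  using ideal.Icarr[OF primeideal.axioms(1)[OF m0_prime]] by auto

lemma m0_zero: "\<zero> \<in> m0"
  using additive_subgroup.zero_closed[OF ideal.axioms(1)[OF primeideal.axioms(1)[OF m0_prime]]]
  by simp

lemma m0_add: "a \<in> m0 \<Longrightarrow> b \<in> m0 \<Longrightarrow> a \<oplus> b \<in> m0"
  using additive_subgroup.a_closed[OF ideal.axioms(1)[OF primeideal.axioms(1)[OF m0_prime]]]
  by simp

lemma m0_mult: "a \<in> A 0 \<Longrightarrow> b \<in> m0 \<Longrightarrow> a \<otimes> b \<in> m0"
  using ideal.I_l_closed[OF primeideal.axioms(1)[OF m0_prime], of b a] by simp

lemma m0_neg: "a \<in> m0 \<Longrightarrow> \<ominus> a \<in> m0"
proof -
  assume a: "a \<in> m0"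
  then have "a \<in> carrier R" using m0_subset piece_closed by blast
  then have "\<ominus> a = (\<ominus> \<one>) \<otimes> a" by (simp add: l_minus)
  then show "\<ominus> a \<in> m0" using m0_mult[OF piece_neg[OF one_in_piece] a] by simp
qed

lemma m0_primeD: "a \<in> A 0 \<Longrightarrow> b \<in> A 0 \<Longrightarrow> a \<otimes> b \<in> m0 \<Longrightarrow> a \<in> m0 \<or> b \<in> m0"
  using primeideal.I_prime[OF m0_prime, of a b] by simp

lemma one_notin_m0: "\<one> \<notin> m0"
  using ideal.one_imp_carrier[OF primeideal.axioms(1)[OF m0_prime]]
    primeideal.I_notcarr[OF m0_prime] by auto

lemma piece_unit:
  assumes "a \<in> A 0" "a \<notin> m0"
  shows "\<exists>v\<in>A 0. a \<otimes> v = \<one>"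
  using noetherian_local_ring_unit[OF local_piece, of a] assms by (auto simp: Units_def)

text \<open>The homogeneous maximal ideal of R.\<close>

definition mm where "mm = m0 <+>\<^bsub>R\<^esub> positive_part R A"

lemma component_0_one: "comp \<one> 0 = \<one>"
  using component_homogeneous[OF one_in_piece] by simp

lemma positive_part_component_0:
  assumes "b \<in> positive_part R A"
  shows "b \<in> carrier R" "comp b 0 = \<zero>"
proof -
  let ?J = "{r \<in> carrier R. comp r 0 = \<zero>}"
  have "ideal ?J R"
  proof (rule idealI)
    show "ring R" by (rule ring_axioms)
    show "subgroup ?J (add_monoid R)"
      by (rule add.subgroupI) (auto simp: component_add component_neg simp flip: a_inv_def)
  qed (auto simp: component_0_mult)
  moreover have "(\<Union>n\<in>{0<..}. A n) \<subseteq> ?J"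
    using piece_closed component_homogeneous by auto
  ultimately have "positive_part R A \<subseteq> ?J"
    unfolding positive_part_def by (rule genideal_minimal)
  then show "b \<in> carrier R" "comp b 0 = \<zero>" using assms by auto
qed

lemma remainder_in_positive_part:
  assumes "s \<in> carrier R"
  shows "s \<ominus> comp s 0 \<in> positive_part R A"
  using assms
proof (induction rule: homogeneous_induct)
  have sub: "(\<Union>n\<in>{0<..}. A n) \<subseteq> carrier R" using piece_closed by auto
  interpret I: ideal "positive_part R A" R
    unfolding positive_part_def by (rule genideal_ideal[OF sub])
  note self = genideal_self[OF sub, folded positive_part_def]
  { case zero
    show ?case using I.zero_closed by (simp add: a_minus_def) }
  { case (homogeneous i y)
    then show ?case
      using I.zero_closed self piece_closed[OF homogeneous] component_homogeneous[OF homogeneous]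
      by (cases "i = 0") (auto simp: a_minus_def r_neg) }
  { case (add y z)
    have "(y \<oplus> z) \<ominus> comp (y \<oplus> z) 0 = (y \<ominus> comp y 0) \<oplus> (z \<ominus> comp z 0)"
      using add by (simp add: component_add a_minus_def minus_add a_ac)
    then show ?case using add I.a_closed by simp }
qed

text \<open>Elements of positive degree generate an ideal without degree-zero components, and this ideal
  contains the difference of s and its degree-zero component.\<close>

lemma mem_mm_iff:
  assumes "s \<in> carrier R"
  shows "s \<in> mm \<longleftrightarrow> comp s 0 \<in> m0"
proof
  assume "s \<in> mm"
  then obtain a b where ab: "a \<in> m0" "b \<in> positive_part R A" "s = a \<oplus> b"
    unfolding mm_def set_add_def' by auto
  have "a \<in> A 0" "a \<in> carrier R" using ab m0_subset piece_closed by auto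
  then have "comp s 0 = a"
    using ab positive_part_component_0[OF ab(2)] component_homogeneous[of a 0 0]
    by (simp add: component_add)
  then show "comp s 0 \<in> m0" using ab by simp
next
  assume "comp s 0 \<in> m0"
  moreover have "s = comp s 0 \<oplus> (s \<ominus> comp s 0)"
    using assms by (simp add: a_minus_def a_lcomm r_neg)
  ultimately show "s \<in> mm"
    unfolding mm_def set_add_def' using remainder_in_positive_part[OF assms] by auto
qed

lemma one_notin_mm: "\<one> \<notin> mm"
  using mem_mm_iff component_0_one one_notin_m0 by simp

lemma mm_complement_mult:
  assumes "s \<in> carrier R - mm" "t \<in> carrier R - mm"
  shows "s \<otimes> t \<in> carrier R - mm"
  using assms m0_primeD[of "comp s 0" "comp t 0"] component_in[of s 0] component_in[of t 0]
  by (auto simp: mem_mm_iff component_0_mult)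

text \<open>An element with invertible degree-zero component has an inverse in the product of the
  homogeneous pieces, whose truncations lie in R. They are found degree by degree: if t inverts s
  below degree n, the remaining error in degree n is removed by adding to t that error divided by
  the degree-zero component of s.\<close>

lemma truncated_inverse:
  assumes "s \<in> carrier R - mm"
  shows "\<exists>t\<in>carrier R. agree n (s \<otimes> t) \<one>"
proof (induction n)
  case 0
  show ?case using assms by (auto simp: agree_def)
next
  case (Suc n)
  have s: "s \<in> carrier R" "comp s 0 \<notin> m0" using assms mem_mm_iff by auto
  obtain t where t: "t \<in> carrier R" "agree n (s \<otimes> t) \<one>" using Suc by blast
  obtain v where v: "v \<in> A 0" "comp s 0 \<otimes> v = \<one>" "v \<in> carrier R"
    using piece_unit[OF component_in[OF s(1)] s(2)] piece_closed by blast
  define d where "d = comp (\<one> \<ominus> s \<otimes> t) n"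
  have d: "d \<in> A n" "d \<in> carrier R" using s t by (auto simp: d_def intro: component_in)
  have vd: "v \<otimes> d \<in> A n" using piece_mult[OF v(1) d(1)] by simp
  have cl: "v \<otimes> d \<in> carrier R" using v d by simp
  have "comp (s \<otimes> (t \<oplus> v \<otimes> d)) i = comp \<one> i" if "i < Suc n" for i
  proof -
    have "comp (s \<otimes> (t \<oplus> v \<otimes> d)) i = comp (s \<otimes> t) i \<oplus> comp ((v \<otimes> d) \<otimes> s) i"
      using s t cl m_comm by (simp add: r_distr component_add)
    also have "comp ((v \<otimes> d) \<otimes> s) i = (if n \<le> i then (v \<otimes> d) \<otimes> comp s (i - n) else \<zero>)"
      by (rule component_homogeneous_mult[OF vd s(1)])
    also have "comp (s \<otimes> t) i \<oplus> \<dots> = comp \<one> i"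
    proof (cases "i = n")
      case True
      have "(v \<otimes> d) \<otimes> comp s 0 = (comp s 0 \<otimes> v) \<otimes> d"
        using v d s by (simp add: m_ac)
      also have "\<dots> = comp \<one> n \<ominus> comp (s \<otimes> t) n"
        unfolding v(2) using d s t by (simp add: d_def component_diff)
      finally show ?thesis using True s t by (simp add: a_minus_def a_lcomm r_neg)
    next
      case False
      then have "i < n" using that by simp
      then show ?thesis using t s agree_component[OF t(2)] by simp
    qed
    finally show ?thesis .
  qed
  then have "agree (Suc n) (s \<otimes> (t \<oplus> v \<otimes> d)) \<one>" using s t cl by (simp add: agree_def)
  then show ?case using t cl by blast
qed

lemma agree_cancel:
  assumes "s \<in> carrier R - mm" "agree n (s \<otimes> a) (s \<otimes> b)" "a \<in> carrier R" "b \<in> carrier R"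
  shows "agree n a b"
proof -
  obtain t where t: "t \<in> carrier R" "agree n (s \<otimes> t) \<one>"
    using truncated_inverse[OF assms(1), of n] by blast
  have s: "s \<in> carrier R" using assms by simp
  have *: "agree n x (t \<otimes> (s \<otimes> x))" if "x \<in> carrier R" for x
  proof -
    have "agree n (\<one> \<otimes> x) ((s \<otimes> t) \<otimes> x)"
      by (rule agree_mult[OF agree_sym[OF t(2)] agree_refl[OF that]])
    moreover have "(s \<otimes> t) \<otimes> x = t \<otimes> (s \<otimes> x)" using that s t by (simp add: m_ac)
    ultimately show ?thesis using that by simp
  qed
  have "agree n a (t \<otimes> (s \<otimes> a))" by (rule *[OF assms(3)])
  also have "agree n \<dots> (t \<otimes> (s \<otimes> b))"
    by (rule agree_mult[OF agree_refl[OF t(1)] assms(2)])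
  also have "agree n \<dots> b" by (rule agree_sym[OF *[OF assms(4)]])
  finally show ?thesis .
qed

end

section \<open>Modules of fractions and their Frobenius pushforwards\<close>

lemma regular_module_simps [simp]:
  "carrier (regular_module R) = carrier R" "\<zero>\<^bsub>regular_module R\<^esub> = \<zero>\<^bsub>R\<^esub>"
  "x \<oplus>\<^bsub>regular_module R\<^esub> y = x \<oplus>\<^bsub>R\<^esub> y" "x \<odot>\<^bsub>regular_module R\<^esub> y = x \<otimes>\<^bsub>R\<^esub> y"
  by (simp_all add: regular_module_def)

lemma (in cring) regular_module_is_module: "module R (regular_module R)"
proof (rule moduleI)
  show "abelian_group (regular_module R)"
    by (rule abelian_groupI) (auto simp: a_ac intro: bexI[of _ "\<ominus> _"] l_neg)
qed (auto simp: is_cring l_distr r_distr m_assoc)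

lemma frobenius_pushforward_simps [simp]:
  "carrier (frobenius_pushforward R p e M) = carrier M"
  "\<zero>\<^bsub>frobenius_pushforward R p e M\<^esub> = \<zero>\<^bsub>M\<^esub>"
  "x \<oplus>\<^bsub>frobenius_pushforward R p e M\<^esub> y = x \<oplus>\<^bsub>M\<^esub> y"
  "a \<odot>\<^bsub>frobenius_pushforward R p e M\<^esub> x = (a [^]\<^bsub>R\<^esub> (p ^ e)) \<odot>\<^bsub>M\<^esub> x"
  by (simp_all add: frobenius_pushforward_def)

lemma free_module_simps:
  "carrier (free_module R n) = {..<n} \<rightarrow>\<^sub>E carrier R"
  "x \<oplus>\<^bsub>free_module R n\<^esub> y = (\<lambda>i\<in>{..<n}. x i \<oplus>\<^bsub>R\<^esub> y i)"
  "a \<odot>\<^bsub>free_module R n\<^esub> x = (\<lambda>i\<in>{..<n}. a \<otimes>\<^bsub>R\<^esub> x i)"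
  by (simp_all add: free_module_def)

lemma frobenius_hom_free_iff:
  fixes R :: "('a, 'r) ring_scheme" and M :: "('a, 'b, 'm) module_scheme"
  assumes closed: "\<And>x y. x \<in> carrier M \<Longrightarrow> y \<in> carrier M \<Longrightarrow> x \<oplus>\<^bsub>M\<^esub> y \<in> carrier M"
    "\<And>a x. a \<in> carrier R \<Longrightarrow> x \<in> carrier M \<Longrightarrow> (a [^]\<^bsub>R\<^esub> (p ^ e)) \<odot>\<^bsub>M\<^esub> x \<in> carrier M"
  shows "f \<in> module_hom R (frobenius_pushforward R p e M) (free_module R n) \<longleftrightarrow>
    f \<in> carrier M \<rightarrow> ({..<n} \<rightarrow>\<^sub>E carrier R) \<and>
    (\<forall>i<n. (\<forall>x\<in>carrier M. \<forall>y\<in>carrier M. f (x \<oplus>\<^bsub>M\<^esub> y) i = f x i \<oplus>\<^bsub>R\<^esub> f y i) \<and>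
      (\<forall>a\<in>carrier R. \<forall>x\<in>carrier M. f ((a [^]\<^bsub>R\<^esub> (p ^ e)) \<odot>\<^bsub>M\<^esub> x) i = a \<otimes>\<^bsub>R\<^esub> f x i))"
proof -
  have ext: "f u = restrict g {..<n} \<longleftrightarrow> (\<forall>i<n. f u i = g i)"
    if "f \<in> carrier M \<rightarrow> ({..<n} \<rightarrow>\<^sub>E carrier R)" "u \<in> carrier M" for u and g :: "nat \<Rightarrow> 'a"
  proof -
    have "f u \<in> {..<n} \<rightarrow>\<^sub>E carrier R" using that by blast
    then show ?thesis by (auto simp: PiE_def extensional_def fun_eq_iff)
  qed
  show ?thesis
  proof (cases "f \<in> carrier M \<rightarrow> ({..<n} \<rightarrow>\<^sub>E carrier R)")
    case True
    have 1: "f (x \<oplus>\<^bsub>M\<^esub> y) = (\<lambda>i\<in>{..<n}. f x i \<oplus>\<^bsub>R\<^esub> f y i)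
        \<longleftrightarrow> (\<forall>i<n. f (x \<oplus>\<^bsub>M\<^esub> y) i = f x i \<oplus>\<^bsub>R\<^esub> f y i)"
      if "x \<in> carrier M" "y \<in> carrier M" for x y
      by (rule ext[OF True closed(1)[OF that]])
    have 2: "f ((a [^]\<^bsub>R\<^esub> (p ^ e)) \<odot>\<^bsub>M\<^esub> x) = (\<lambda>i\<in>{..<n}. a \<otimes>\<^bsub>R\<^esub> f x i)
        \<longleftrightarrow> (\<forall>i<n. f ((a [^]\<^bsub>R\<^esub> (p ^ e)) \<odot>\<^bsub>M\<^esub> x) i = a \<otimes>\<^bsub>R\<^esub> f x i)"
      if "a \<in> carrier R" "x \<in> carrier M" for a x
      by (rule ext[OF True closed(2)[OF that]])
    show ?thesis
      using True by (simp add: module_hom_def hom_def free_module_simps 1 2) blast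
  qed (auto simp: module_hom_def hom_def free_module_simps)
qed

lemma UN_pair_const:
  assumes "(x0, s0) \<in> V" "\<And>x s. (x, s) \<in> V \<Longrightarrow> F x s = C"
  shows "(\<Union>(x, s)\<in>V. F x s) = C"
  using assms by fastforce


locale localization = module R M for R :: "('a, 'r) ring_scheme" (structure)
    and M :: "('a, 'b, 'm) module_scheme" (structure) +
  fixes P :: "'a set"
  assumes one_notin: "\<one>\<^bsub>R\<^esub> \<notin> P"
    and complement_mult: "s \<in> carrier R - P \<Longrightarrow> t \<in> carrier R - P \<Longrightarrow> s \<otimes>\<^bsub>R\<^esub> t \<in> carrier R - P"
begin

lemma complement_one: "\<one>\<^bsub>R\<^esub> \<in> carrier R - P"
  using one_notin by simp

lemma complement_pow: "s \<in> carrier R - P \<Longrightarrow> s [^]\<^bsub>R\<^esub> (n::nat) \<in> carrier R - P"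
  using complement_one complement_mult by (induction n) auto

abbreviation frac where "frac x s \<equiv> fraction R P M x s"
abbreviation rfrac where "rfrac a s \<equiv> fraction R P (regular_module R) a s"
abbreviation "RP \<equiv> localized_ring R P"
abbreviation "MP \<equiv> localized_module R P M"

lemma regular_localization: "localization R (regular_module R) P"
  by (intro localization.intro localization_axioms.intro R.regular_module_is_module
      one_notin complement_mult)

lemma fraction_eqI:
  assumes x: "x \<in> carrier M" "y \<in> carrier M"
    and s: "s \<in> carrier R - P" "t \<in> carrier R - P" "u \<in> carrier R - P"
    and eq: "u \<odot>\<^bsub>M\<^esub> (t \<odot>\<^bsub>M\<^esub> x) = u \<odot>\<^bsub>M\<^esub> (s \<odot>\<^bsub>M\<^esub> y)"
  shows "frac x s = frac y t"
proof -
  have sub: "frac x' s' \<subseteq> frac y' t'"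
    if x': "x' \<in> carrier M" "y' \<in> carrier M" and s': "s' \<in> carrier R - P" "t' \<in> carrier R - P"
      and eq': "u \<odot>\<^bsub>M\<^esub> (t' \<odot>\<^bsub>M\<^esub> x') = u \<odot>\<^bsub>M\<^esub> (s' \<odot>\<^bsub>M\<^esub> y')" for x' y' s' t'
  proof (clarsimp simp: fraction_def)
    fix z r v
    assume z: "z \<in> carrier M" and r: "r \<in> carrier R" "r \<notin> P" and v: "v \<in> carrier R" "v \<notin> P"
      and vz: "v \<odot>\<^bsub>M\<^esub> (r \<odot>\<^bsub>M\<^esub> x') = v \<odot>\<^bsub>M\<^esub> (s' \<odot>\<^bsub>M\<^esub> z)"
    let ?w = "(u \<otimes>\<^bsub>R\<^esub> v) \<otimes>\<^bsub>R\<^esub> s'"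
    have w: "?w \<in> carrier R - P" using s s' v complement_mult by auto
    have cl: "u \<in> carrier R" "s' \<in> carrier R" "t' \<in> carrier R" using s s' by auto
    have "?w \<odot>\<^bsub>M\<^esub> (r \<odot>\<^bsub>M\<^esub> y') = (v \<otimes>\<^bsub>R\<^esub> r) \<odot>\<^bsub>M\<^esub> (u \<odot>\<^bsub>M\<^esub> (s' \<odot>\<^bsub>M\<^esub> y'))"
      using cl r v x' by (simp add: smult_assoc1[symmetric] R.m_ac)
    also have "\<dots> = (v \<otimes>\<^bsub>R\<^esub> r) \<odot>\<^bsub>M\<^esub> (u \<odot>\<^bsub>M\<^esub> (t' \<odot>\<^bsub>M\<^esub> x'))" by (simp only: eq')
    also have "\<dots> = (u \<otimes>\<^bsub>R\<^esub> t') \<odot>\<^bsub>M\<^esub> (v \<odot>\<^bsub>M\<^esub> (r \<odot>\<^bsub>M\<^esub> x'))"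
      using cl r v x' by (simp add: smult_assoc1[symmetric] R.m_ac)
    also have "\<dots> = (u \<otimes>\<^bsub>R\<^esub> t') \<odot>\<^bsub>M\<^esub> (v \<odot>\<^bsub>M\<^esub> (s' \<odot>\<^bsub>M\<^esub> z))" by (simp only: vz)
    also have "\<dots> = ?w \<odot>\<^bsub>M\<^esub> (t' \<odot>\<^bsub>M\<^esub> z)"
      using cl v z by (simp add: smult_assoc1[symmetric] R.m_ac)
    finally show "\<exists>u\<in>carrier R - P. u \<odot>\<^bsub>M\<^esub> (r \<odot>\<^bsub>M\<^esub> y') = u \<odot>\<^bsub>M\<^esub> (t' \<odot>\<^bsub>M\<^esub> z)"
      using w by blast
  qed
  show ?thesis using sub[OF x s(1,2) eq] sub[OF x(2,1) s(2,1) eq[symmetric]] by blast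
qed

lemma fraction_self: "x \<in> carrier M \<Longrightarrow> s \<in> carrier R - P \<Longrightarrow> (x, s) \<in> frac x s"
  unfolding fraction_def using one_notin by auto

lemma fraction_memD:
  assumes "(y, t) \<in> frac x s"
  shows "y \<in> carrier M" "t \<in> carrier R - P"
    "\<exists>u\<in>carrier R - P. u \<odot>\<^bsub>M\<^esub> (t \<odot>\<^bsub>M\<^esub> x) = u \<odot>\<^bsub>M\<^esub> (s \<odot>\<^bsub>M\<^esub> y)"
  using assms by (auto simp: fraction_def)

lemma fraction_cancel:
  assumes "x \<in> carrier M" "s \<in> carrier R - P" "t \<in> carrier R - P"
  shows "frac (t \<odot>\<^bsub>M\<^esub> x) (t \<otimes>\<^bsub>R\<^esub> s) = frac x s"
proof -
  have "t \<in> carrier R" "s \<in> carrier R" using assms by auto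
  then show ?thesis
    using assms complement_one complement_mult
    by (intro fraction_eqI[where u = "\<one>\<^bsub>R\<^esub>"]) (auto simp: smult_assoc1[symmetric] R.m_ac)
qed

lemma carrier_MP: "carrier MP = {frac x s | x s. x \<in> carrier M \<and> s \<in> carrier R - P}"
  by (simp add: localized_module_def)

lemma carrier_RP: "carrier RP = {rfrac a s | a s. a \<in> carrier R \<and> s \<in> carrier R - P}"
  by (simp add: localized_ring_def localized_module_def)

lemma fraction_add:
  assumes "x \<in> carrier M" "s \<in> carrier R - P" "y \<in> carrier M" "t \<in> carrier R - P"
  shows "frac x s \<oplus>\<^bsub>MP\<^esub> frac y t = frac ((t \<odot>\<^bsub>M\<^esub> x) \<oplus>\<^bsub>M\<^esub> (s \<odot>\<^bsub>M\<^esub> y)) (s \<otimes>\<^bsub>R\<^esub> t)"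
proof -
  let ?C = "frac ((t \<odot>\<^bsub>M\<^esub> x) \<oplus>\<^bsub>M\<^esub> (s \<odot>\<^bsub>M\<^esub> y)) (s \<otimes>\<^bsub>R\<^esub> t)"
  have "frac ((t' \<odot>\<^bsub>M\<^esub> x') \<oplus>\<^bsub>M\<^esub> (s' \<odot>\<^bsub>M\<^esub> y')) (s' \<otimes>\<^bsub>R\<^esub> t') = ?C"
    if "(x', s') \<in> frac x s" "(y', t') \<in> frac y t" for x' s' y' t'
  proof -
    note x' = fraction_memD[OF that(1)] and y' = fraction_memD[OF that(2)]
    obtain u where u: "u \<in> carrier R - P" "u \<odot>\<^bsub>M\<^esub> (s' \<odot>\<^bsub>M\<^esub> x) = u \<odot>\<^bsub>M\<^esub> (s \<odot>\<^bsub>M\<^esub> x')"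
      using x'(3) by blast
    obtain v where v: "v \<in> carrier R - P" "v \<odot>\<^bsub>M\<^esub> (t' \<odot>\<^bsub>M\<^esub> y) = v \<odot>\<^bsub>M\<^esub> (t \<odot>\<^bsub>M\<^esub> y')"
      using y'(3) by blast
    have cl: "s \<in> carrier R" "t \<in> carrier R" "s' \<in> carrier R" "t' \<in> carrier R"
      "u \<in> carrier R" "v \<in> carrier R" using assms x' y' u v by auto
    have "(u \<otimes>\<^bsub>R\<^esub> v) \<odot>\<^bsub>M\<^esub> ((s \<otimes>\<^bsub>R\<^esub> t) \<odot>\<^bsub>M\<^esub> ((t' \<odot>\<^bsub>M\<^esub> x') \<oplus>\<^bsub>M\<^esub> (s' \<odot>\<^bsub>M\<^esub> y')))
        = (v \<otimes>\<^bsub>R\<^esub> t \<otimes>\<^bsub>R\<^esub> t') \<odot>\<^bsub>M\<^esub> (u \<odot>\<^bsub>M\<^esub> (s \<odot>\<^bsub>M\<^esub> x')) \<oplus>\<^bsub>M\<^esub> (u \<otimes>\<^bsub>R\<^esub> s \<otimes>\<^bsub>R\<^esub> s') \<odot>\<^bsub>M\<^esub> (v \<odot>\<^bsub>M\<^esub> (t \<odot>\<^bsub>M\<^esub> y'))"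
      using cl x' y' by (simp add: smult_assoc1[symmetric] smult_r_distr R.m_ac)
    also have "\<dots> = (v \<otimes>\<^bsub>R\<^esub> t \<otimes>\<^bsub>R\<^esub> t') \<odot>\<^bsub>M\<^esub> (u \<odot>\<^bsub>M\<^esub> (s' \<odot>\<^bsub>M\<^esub> x)) \<oplus>\<^bsub>M\<^esub> (u \<otimes>\<^bsub>R\<^esub> s \<otimes>\<^bsub>R\<^esub> s') \<odot>\<^bsub>M\<^esub> (v \<odot>\<^bsub>M\<^esub> (t' \<odot>\<^bsub>M\<^esub> y))"
      by (simp only: u v)
    also have "\<dots> = (u \<otimes>\<^bsub>R\<^esub> v) \<odot>\<^bsub>M\<^esub> ((s' \<otimes>\<^bsub>R\<^esub> t') \<odot>\<^bsub>M\<^esub> ((t \<odot>\<^bsub>M\<^esub> x) \<oplus>\<^bsub>M\<^esub> (s \<odot>\<^bsub>M\<^esub> y)))"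
      using cl assms by (simp add: smult_assoc1[symmetric] smult_r_distr R.m_ac)
    finally show ?thesis
      using assms x' y' cl complement_mult u v
      by (intro fraction_eqI[where u = "u \<otimes>\<^bsub>R\<^esub> v"]) auto
  qed
  then have "(\<Union>(x', s')\<in>frac x s. \<Union>(y', t')\<in>frac y t.
      frac ((t' \<odot>\<^bsub>M\<^esub> x') \<oplus>\<^bsub>M\<^esub> (s' \<odot>\<^bsub>M\<^esub> y')) (s' \<otimes>\<^bsub>R\<^esub> t')) = ?C"
    by (intro UN_pair_const[OF fraction_self[OF assms(1,2)]] UN_pair_const[OF fraction_self[OF assms(3,4)]])
  then show ?thesis by (simp add: localized_module_def)
qed

lemma fraction_smult:
  assumes "a \<in> carrier R" "s \<in> carrier R - P" "x \<in> carrier M" "t \<in> carrier R - P"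
  shows "rfrac a s \<odot>\<^bsub>MP\<^esub> frac x t = frac (a \<odot>\<^bsub>M\<^esub> x) (s \<otimes>\<^bsub>R\<^esub> t)"
proof -
  interpret reg: localization R "regular_module R" P by (rule regular_localization)
  let ?C = "frac (a \<odot>\<^bsub>M\<^esub> x) (s \<otimes>\<^bsub>R\<^esub> t)"
  have "frac (a' \<odot>\<^bsub>M\<^esub> x') (s' \<otimes>\<^bsub>R\<^esub> t') = ?C"
    if "(a', s') \<in> rfrac a s" "(x', t') \<in> frac x t" for a' s' x' t'
  proof -
    note a' = reg.fraction_memD[OF that(1), simplified] and x' = fraction_memD[OF that(2)]
    obtain u where u: "u \<in> carrier R - P" "u \<otimes>\<^bsub>R\<^esub> (s' \<otimes>\<^bsub>R\<^esub> a) = u \<otimes>\<^bsub>R\<^esub> (s \<otimes>\<^bsub>R\<^esub> a')"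
      using a'(3) by blast
    obtain v where v: "v \<in> carrier R - P" "v \<odot>\<^bsub>M\<^esub> (t' \<odot>\<^bsub>M\<^esub> x) = v \<odot>\<^bsub>M\<^esub> (t \<odot>\<^bsub>M\<^esub> x')"
      using x'(3) by blast
    have cl: "s \<in> carrier R" "t \<in> carrier R" "s' \<in> carrier R" "t' \<in> carrier R"
      "u \<in> carrier R" "v \<in> carrier R" "a' \<in> carrier R" using assms x' a' u v by auto
    have "(u \<otimes>\<^bsub>R\<^esub> v) \<odot>\<^bsub>M\<^esub> ((s \<otimes>\<^bsub>R\<^esub> t) \<odot>\<^bsub>M\<^esub> (a' \<odot>\<^bsub>M\<^esub> x'))
        = (u \<otimes>\<^bsub>R\<^esub> (s \<otimes>\<^bsub>R\<^esub> a')) \<odot>\<^bsub>M\<^esub> (v \<odot>\<^bsub>M\<^esub> (t \<odot>\<^bsub>M\<^esub> x'))"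
      using cl x' by (simp add: smult_assoc1[symmetric] R.m_ac)
    also have "\<dots> = (u \<otimes>\<^bsub>R\<^esub> (s' \<otimes>\<^bsub>R\<^esub> a)) \<odot>\<^bsub>M\<^esub> (v \<odot>\<^bsub>M\<^esub> (t' \<odot>\<^bsub>M\<^esub> x))"
      by (simp only: u v)
    also have "\<dots> = (u \<otimes>\<^bsub>R\<^esub> v) \<odot>\<^bsub>M\<^esub> ((s' \<otimes>\<^bsub>R\<^esub> t') \<odot>\<^bsub>M\<^esub> (a \<odot>\<^bsub>M\<^esub> x))"
      using cl assms by (simp add: smult_assoc1[symmetric] R.m_ac)
    finally show ?thesis
      using assms x' a' cl complement_mult u v
      by (intro fraction_eqI[where u = "u \<otimes>\<^bsub>R\<^esub> v"]) auto
  qed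
  then have "(\<Union>(a', s')\<in>rfrac a s. \<Union>(x', t')\<in>frac x t. frac (a' \<odot>\<^bsub>M\<^esub> x') (s' \<otimes>\<^bsub>R\<^esub> t')) = ?C"
    using assms by (intro UN_pair_const[OF reg.fraction_self] UN_pair_const[OF fraction_self[OF assms(3,4)]]) simp_all
  then show ?thesis by (simp add: localized_module_def)
qed

lemma rfraction_add:
  assumes "a \<in> carrier R" "s \<in> carrier R - P" "b \<in> carrier R" "t \<in> carrier R - P"
  shows "rfrac a s \<oplus>\<^bsub>RP\<^esub> rfrac b t = rfrac ((t \<otimes>\<^bsub>R\<^esub> a) \<oplus>\<^bsub>R\<^esub> (s \<otimes>\<^bsub>R\<^esub> b)) (s \<otimes>\<^bsub>R\<^esub> t)"
  using localization.fraction_add[OF regular_localization, of a s b t] assms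
  by (simp add: localized_ring_def)

lemma rfraction_mult:
  assumes "a \<in> carrier R" "s \<in> carrier R - P" "b \<in> carrier R" "t \<in> carrier R - P"
  shows "rfrac a s \<otimes>\<^bsub>RP\<^esub> rfrac b t = rfrac (a \<otimes>\<^bsub>R\<^esub> b) (s \<otimes>\<^bsub>R\<^esub> t)"
  using localization.fraction_smult[OF regular_localization, of a s b t] assms
  by (simp add: localized_ring_def)

lemma RP_one: "\<one>\<^bsub>RP\<^esub> = rfrac \<one>\<^bsub>R\<^esub> \<one>\<^bsub>R\<^esub>"
  by (simp add: localized_ring_def)

lemma rfraction_pow:
  assumes "a \<in> carrier R" "s \<in> carrier R - P"
  shows "rfrac a s [^]\<^bsub>RP\<^esub> (n::nat) = rfrac (a [^]\<^bsub>R\<^esub> n) (s [^]\<^bsub>R\<^esub> n)"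
proof (induction n)
  case 0
  then show ?case by (simp add: nat_pow_def RP_one)
next
  case (Suc n)
  have "rfrac a s [^]\<^bsub>RP\<^esub> Suc n = rfrac a s [^]\<^bsub>RP\<^esub> n \<otimes>\<^bsub>RP\<^esub> rfrac a s"
    by (simp add: nat_pow_def)
  then show ?case
    using Suc rfraction_mult[OF _ complement_pow[OF assms(2)] assms] assms(1) by simp
qed

lemma rfrac_in: "a \<in> carrier R \<Longrightarrow> s \<in> carrier R - P \<Longrightarrow> rfrac a s \<in> carrier RP"
  unfolding carrier_RP by blast

lemma frac_in: "x \<in> carrier M \<Longrightarrow> s \<in> carrier R - P \<Longrightarrow> frac x s \<in> carrier MP"
  unfolding carrier_MP by blast

lemma MP_add_closed:
  assumes "v \<in> carrier MP" "w \<in> carrier MP"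
  shows "v \<oplus>\<^bsub>MP\<^esub> w \<in> carrier MP"
proof -
  obtain x s y t where "v = frac x s" "w = frac y t" and cl: "x \<in> carrier M" "s \<in> carrier R - P"
    "y \<in> carrier M" "t \<in> carrier R - P" using assms unfolding carrier_MP by blast
  then show ?thesis
    using fraction_add[OF cl] complement_mult[OF cl(2,4)] by (auto intro!: frac_in)
qed

lemma MP_pow_smult_closed:
  assumes "r \<in> carrier RP" "w \<in> carrier MP"
  shows "(r [^]\<^bsub>RP\<^esub> (n::nat)) \<odot>\<^bsub>MP\<^esub> w \<in> carrier MP"
proof -
  obtain a s y t where "r = rfrac a s" "w = frac y t" and cl: "a \<in> carrier R" "s \<in> carrier R - P"
    "y \<in> carrier M" "t \<in> carrier R - P" using assms unfolding carrier_RP carrier_MP by blast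
  then show ?thesis
    using complement_pow[OF cl(2), of n] complement_mult
    by (auto simp: rfraction_pow fraction_smult intro!: frac_in)
qed

lemma localized_hom_iff:
  "\<phi> \<in> module_hom RP (frobenius_pushforward RP p e MP) (free_module RP n) \<longleftrightarrow>
    \<phi> \<in> carrier MP \<rightarrow> ({..<n} \<rightarrow>\<^sub>E carrier RP) \<and>
    (\<forall>i<n. (\<forall>v\<in>carrier MP. \<forall>w\<in>carrier MP. \<phi> (v \<oplus>\<^bsub>MP\<^esub> w) i = \<phi> v i \<oplus>\<^bsub>RP\<^esub> \<phi> w i) \<and>
      (\<forall>r\<in>carrier RP. \<forall>w\<in>carrier MP. \<phi> ((r [^]\<^bsub>RP\<^esub> (p ^ e)) \<odot>\<^bsub>MP\<^esub> w) i = r \<otimes>\<^bsub>RP\<^esub> \<phi> w i))"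
  by (rule frobenius_hom_free_iff) (fact MP_add_closed MP_pow_smult_closed)+

lemma common_denominator:
  assumes "finite I" "\<And>i. i \<in> I \<Longrightarrow> w i \<in> carrier RP"
  shows "\<exists>s\<in>carrier R - P. \<forall>i\<in>I. \<exists>a\<in>carrier R. w i = rfrac a s"
  using assms
proof (induction I rule: finite_induct)
  case empty
  then show ?case using complement_one by blast
next
  case (insert j I)
  interpret reg: localization R "regular_module R" P by (rule regular_localization)
  obtain s where s: "s \<in> carrier R - P" "\<forall>i\<in>I. \<exists>a\<in>carrier R. w i = rfrac a s"
    using insert by blast
  obtain b t where b: "b \<in> carrier R" "t \<in> carrier R - P" "w j = rfrac b t"
    using insert.prems[of j] unfolding carrier_RP by blast
  have "w j = rfrac (s \<otimes>\<^bsub>R\<^esub> b) (s \<otimes>\<^bsub>R\<^esub> t)"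
    using reg.fraction_cancel[of b t s] b s by simp
  moreover have "\<exists>a\<in>carrier R. w i = rfrac a (s \<otimes>\<^bsub>R\<^esub> t)" if i: "i \<in> I" for i
  proof -
    obtain a where a: "a \<in> carrier R" "w i = rfrac a s" using s i by blast
    then have "w i = rfrac (t \<otimes>\<^bsub>R\<^esub> a) (s \<otimes>\<^bsub>R\<^esub> t)"
      using reg.fraction_cancel[of a s t] b s R.m_comm by simp
    then show ?thesis using a b by auto
  qed
  ultimately show ?case
    using complement_mult[OF s(1) b(2)] s b by (intro bexI[of _ "s \<otimes>\<^bsub>R\<^esub> t"]) auto
qed

text \<open>In the pushforward of the localization, x/s is the multiple by 1/s of s^(q-1) x, where q =
  p^e. This forces the extension of f to send x/s to f(s^(q-1) x)/s. It is onto because finitely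
  many fractions have a common denominator s, and the multiple by 1/s of x in the pushforward is
  x/s^q.\<close>

lemma frobenius_surjection_localizes:
  assumes p: "p > 0"
    and f: "f \<in> module_hom R (frobenius_pushforward R p e M) (free_module R n)"
    and surj: "f ` carrier M = carrier (free_module R n)"
  shows "\<exists>\<phi>\<in>module_hom RP (frobenius_pushforward RP p e MP) (free_module RP n).
    \<phi> ` carrier MP = carrier (free_module RP n)"
proof -
  interpret reg: localization R "regular_module R" P by (rule regular_localization)
  obtain q where q: "p ^ e = Suc q" using p by (metis gr0_implies_Suc zero_less_power)
  have fcl: "f x \<in> {..<n} \<rightarrow>\<^sub>E carrier R" if "x \<in> carrier M" for x
    using that surj by (auto simp: free_module_simps)
  have fcl': "f x i \<in> carrier R" if "x \<in> carrier M" "i < n" for x i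
    using fcl that by (auto simp: PiE_def)
  have fadd: "f (x \<oplus>\<^bsub>M\<^esub> y) i = f x i \<oplus>\<^bsub>R\<^esub> f y i" if "x \<in> carrier M" "y \<in> carrier M" "i < n" for x y i
    using f that by (subst (asm) frobenius_hom_free_iff) auto
  have fsm: "f (a [^]\<^bsub>R\<^esub> Suc q \<odot>\<^bsub>M\<^esub> x) i = a \<otimes>\<^bsub>R\<^esub> f x i" if "a \<in> carrier R" "x \<in> carrier M" "i < n" for a x i
    using f that unfolding q[symmetric] by (subst (asm) frobenius_hom_free_iff) auto
  define \<phi> where "\<phi> W = (\<lambda>i\<in>{..<n}. \<Union>(x, s)\<in>W. rfrac (f (s [^]\<^bsub>R\<^esub> q \<odot>\<^bsub>M\<^esub> x) i) s)" for W
  have phi: "\<phi> (frac x s) i = rfrac (f (s [^]\<^bsub>R\<^esub> q \<odot>\<^bsub>M\<^esub> x) i) s"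
    if x: "x \<in> carrier M" "s \<in> carrier R - P" "i < n" for x s i
  proof -
    have "rfrac (f (t [^]\<^bsub>R\<^esub> q \<odot>\<^bsub>M\<^esub> y) i) t = rfrac (f (s [^]\<^bsub>R\<^esub> q \<odot>\<^bsub>M\<^esub> x) i) s"
      if "(y, t) \<in> frac x s" for y t
    proof -
      note y = fraction_memD[OF that]
      obtain u where u: "u \<in> carrier R - P" "u \<odot>\<^bsub>M\<^esub> (t \<odot>\<^bsub>M\<^esub> x) = u \<odot>\<^bsub>M\<^esub> (s \<odot>\<^bsub>M\<^esub> y)"
        using y(3) by blast
      have cl: "s \<in> carrier R" "t \<in> carrier R" "u \<in> carrier R" using x y u by auto
      have "(u \<otimes>\<^bsub>R\<^esub> s) \<otimes>\<^bsub>R\<^esub> f (t [^]\<^bsub>R\<^esub> q \<odot>\<^bsub>M\<^esub> y) i = f ((u \<otimes>\<^bsub>R\<^esub> s) [^]\<^bsub>R\<^esub> Suc q \<odot>\<^bsub>M\<^esub> (t [^]\<^bsub>R\<^esub> q \<odot>\<^bsub>M\<^esub> y)) i"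
        using fsm[of "u \<otimes>\<^bsub>R\<^esub> s"] cl y x by simp
      also have "(u \<otimes>\<^bsub>R\<^esub> s) [^]\<^bsub>R\<^esub> Suc q \<odot>\<^bsub>M\<^esub> (t [^]\<^bsub>R\<^esub> q \<odot>\<^bsub>M\<^esub> y)
          = (u [^]\<^bsub>R\<^esub> q \<otimes>\<^bsub>R\<^esub> s [^]\<^bsub>R\<^esub> q \<otimes>\<^bsub>R\<^esub> t [^]\<^bsub>R\<^esub> q) \<odot>\<^bsub>M\<^esub> (u \<odot>\<^bsub>M\<^esub> (s \<odot>\<^bsub>M\<^esub> y))"
        using cl y by (simp add: R.nat_pow_distrib smult_assoc1[symmetric] R.m_ac)
      also have "\<dots> = (u [^]\<^bsub>R\<^esub> q \<otimes>\<^bsub>R\<^esub> s [^]\<^bsub>R\<^esub> q \<otimes>\<^bsub>R\<^esub> t [^]\<^bsub>R\<^esub> q) \<odot>\<^bsub>M\<^esub> (u \<odot>\<^bsub>M\<^esub> (t \<odot>\<^bsub>M\<^esub> x))"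
        by (simp only: u)
      also have "\<dots> = (u \<otimes>\<^bsub>R\<^esub> t) [^]\<^bsub>R\<^esub> Suc q \<odot>\<^bsub>M\<^esub> (s [^]\<^bsub>R\<^esub> q \<odot>\<^bsub>M\<^esub> x)"
        using cl x by (simp add: R.nat_pow_distrib smult_assoc1[symmetric] R.m_ac)
      also have "f \<dots> i = (u \<otimes>\<^bsub>R\<^esub> t) \<otimes>\<^bsub>R\<^esub> f (s [^]\<^bsub>R\<^esub> q \<odot>\<^bsub>M\<^esub> x) i"
        using fsm[of "u \<otimes>\<^bsub>R\<^esub> t"] cl x by simp
      finally show ?thesis
        using x y u cl fcl'[of "t [^]\<^bsub>R\<^esub> q \<odot>\<^bsub>M\<^esub> y" i] fcl'[of "s [^]\<^bsub>R\<^esub> q \<odot>\<^bsub>M\<^esub> x" i]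
        by (intro reg.fraction_eqI[where u = u]) (simp_all add: R.m_assoc)
    qed
    then have "(\<Union>(y, t)\<in>frac x s. rfrac (f (t [^]\<^bsub>R\<^esub> q \<odot>\<^bsub>M\<^esub> y) i) t) = rfrac (f (s [^]\<^bsub>R\<^esub> q \<odot>\<^bsub>M\<^esub> x) i) s"
      by (intro UN_pair_const[OF fraction_self[OF x(1,2)]])
    then show ?thesis using x by (simp add: \<phi>_def)
  qed
  have phi_in: "\<phi> W \<in> {..<n} \<rightarrow>\<^sub>E carrier RP" if W: "W \<in> carrier MP" for W
  proof -
    obtain x s where W: "W = frac x s" "x \<in> carrier M" "s \<in> carrier R - P"
      using W unfolding carrier_MP by blast
    have "\<phi> W i \<in> carrier RP" if "i < n" for i
      using phi[of x s i] W that by (auto intro!: rfrac_in fcl')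
    then show ?thesis by (auto simp: \<phi>_def)
  qed
  have "\<phi> \<in> module_hom RP (frobenius_pushforward RP p e MP) (free_module RP n)"
    unfolding localized_hom_iff
  proof (intro conjI allI impI ballI)
    show "\<phi> \<in> carrier MP \<rightarrow> {..<n} \<rightarrow>\<^sub>E carrier RP" using phi_in by blast
    fix i assume i: "i < n"
    { fix v w assume "v \<in> carrier MP" "w \<in> carrier MP"
      then obtain x s y t where v: "v = frac x s" and w: "w = frac y t"
        and cl: "x \<in> carrier M" "s \<in> carrier R - P" "y \<in> carrier M" "t \<in> carrier R - P"
        unfolding carrier_MP by blast
      have st: "s \<in> carrier R" "t \<in> carrier R" using cl by auto
      have "\<phi> (v \<oplus>\<^bsub>MP\<^esub> w) i = rfrac (f ((s \<otimes>\<^bsub>R\<^esub> t) [^]\<^bsub>R\<^esub> q \<odot>\<^bsub>M\<^esub> (t \<odot>\<^bsub>M\<^esub> x \<oplus>\<^bsub>M\<^esub> s \<odot>\<^bsub>M\<^esub> y)) i) (s \<otimes>\<^bsub>R\<^esub> t)"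
        unfolding v w fraction_add[OF cl] using cl st i complement_mult[OF cl(2,4)]
        by (intro phi) auto
      also have "(s \<otimes>\<^bsub>R\<^esub> t) [^]\<^bsub>R\<^esub> q \<odot>\<^bsub>M\<^esub> (t \<odot>\<^bsub>M\<^esub> x \<oplus>\<^bsub>M\<^esub> s \<odot>\<^bsub>M\<^esub> y)
          = t [^]\<^bsub>R\<^esub> Suc q \<odot>\<^bsub>M\<^esub> (s [^]\<^bsub>R\<^esub> q \<odot>\<^bsub>M\<^esub> x) \<oplus>\<^bsub>M\<^esub> s [^]\<^bsub>R\<^esub> Suc q \<odot>\<^bsub>M\<^esub> (t [^]\<^bsub>R\<^esub> q \<odot>\<^bsub>M\<^esub> y)"
        using cl st by (simp add: R.nat_pow_distrib smult_r_distr smult_assoc1[symmetric] R.m_ac)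
      also have "f \<dots> i = t \<otimes>\<^bsub>R\<^esub> f (s [^]\<^bsub>R\<^esub> q \<odot>\<^bsub>M\<^esub> x) i \<oplus>\<^bsub>R\<^esub> s \<otimes>\<^bsub>R\<^esub> f (t [^]\<^bsub>R\<^esub> q \<odot>\<^bsub>M\<^esub> y) i"
        using cl st i by (simp only: fadd fsm smult_closed R.nat_pow_closed)
      also have "rfrac \<dots> (s \<otimes>\<^bsub>R\<^esub> t) = \<phi> v i \<oplus>\<^bsub>RP\<^esub> \<phi> w i"
        unfolding v w phi[OF cl(1,2) i] phi[OF cl(3,4) i]
        using cl st i by (intro rfraction_add[symmetric] fcl') auto
      finally show "\<phi> (v \<oplus>\<^bsub>MP\<^esub> w) i = \<phi> v i \<oplus>\<^bsub>RP\<^esub> \<phi> w i" . }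
    { fix r w assume "r \<in> carrier RP" "w \<in> carrier MP"
      then obtain a s x t where r: "r = rfrac a s" and w: "w = frac x t"
        and cl: "a \<in> carrier R" "s \<in> carrier R - P" "x \<in> carrier M" "t \<in> carrier R - P"
        unfolding carrier_MP carrier_RP by blast
      have st: "s \<in> carrier R" "t \<in> carrier R" using cl by auto
      let ?y = "f (t [^]\<^bsub>R\<^esub> q \<odot>\<^bsub>M\<^esub> x) i"
      have y: "?y \<in> carrier R" using cl st i by (intro fcl') auto
      have den: "s [^]\<^bsub>R\<^esub> Suc q \<otimes>\<^bsub>R\<^esub> t \<in> carrier R - P"
        using complement_mult[OF complement_pow[OF cl(2)] cl(4)] by blast
      have "r [^]\<^bsub>RP\<^esub> (p ^ e) \<odot>\<^bsub>MP\<^esub> w = frac (a [^]\<^bsub>R\<^esub> Suc q \<odot>\<^bsub>M\<^esub> x) (s [^]\<^bsub>R\<^esub> Suc q \<otimes>\<^bsub>R\<^esub> t)"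
        unfolding r w q rfraction_pow[OF cl(1,2)]
        by (rule fraction_smult[OF _ complement_pow[OF cl(2)] cl(3,4)]) (simp add: cl del: R.nat_pow_Suc)
      then have "\<phi> (r [^]\<^bsub>RP\<^esub> (p ^ e) \<odot>\<^bsub>MP\<^esub> w) i
          = rfrac (f ((s [^]\<^bsub>R\<^esub> Suc q \<otimes>\<^bsub>R\<^esub> t) [^]\<^bsub>R\<^esub> q \<odot>\<^bsub>M\<^esub> (a [^]\<^bsub>R\<^esub> Suc q \<odot>\<^bsub>M\<^esub> x)) i) (s [^]\<^bsub>R\<^esub> Suc q \<otimes>\<^bsub>R\<^esub> t)"
        using phi[OF _ den i] cl by (simp del: R.nat_pow_Suc)
      also have "(s [^]\<^bsub>R\<^esub> Suc q \<otimes>\<^bsub>R\<^esub> t) [^]\<^bsub>R\<^esub> q \<odot>\<^bsub>M\<^esub> (a [^]\<^bsub>R\<^esub> Suc q \<odot>\<^bsub>M\<^esub> x)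
          = (s [^]\<^bsub>R\<^esub> q \<otimes>\<^bsub>R\<^esub> a) [^]\<^bsub>R\<^esub> Suc q \<odot>\<^bsub>M\<^esub> (t [^]\<^bsub>R\<^esub> q \<odot>\<^bsub>M\<^esub> x)"
        using cl st by (simp del: R.nat_pow_Suc add: R.nat_pow_distrib R.nat_pow_pow
            smult_assoc1[symmetric] R.m_ac mult.commute)
      also have "f \<dots> i = (s [^]\<^bsub>R\<^esub> q \<otimes>\<^bsub>R\<^esub> a) \<otimes>\<^bsub>R\<^esub> ?y"
        using cl st i by (intro fsm) auto
      also have "\<dots> = s [^]\<^bsub>R\<^esub> q \<otimes>\<^bsub>R\<^esub> (a \<otimes>\<^bsub>R\<^esub> ?y)" using cl st y by (simp add: R.m_assoc)
      also have "s [^]\<^bsub>R\<^esub> Suc q \<otimes>\<^bsub>R\<^esub> t = s [^]\<^bsub>R\<^esub> q \<otimes>\<^bsub>R\<^esub> (s \<otimes>\<^bsub>R\<^esub> t)" using st by (simp add: R.m_assoc)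
      also have "rfrac (s [^]\<^bsub>R\<^esub> q \<otimes>\<^bsub>R\<^esub> (a \<otimes>\<^bsub>R\<^esub> ?y)) (s [^]\<^bsub>R\<^esub> q \<otimes>\<^bsub>R\<^esub> (s \<otimes>\<^bsub>R\<^esub> t)) = rfrac (a \<otimes>\<^bsub>R\<^esub> ?y) (s \<otimes>\<^bsub>R\<^esub> t)"
        using reg.fraction_cancel[of "a \<otimes>\<^bsub>R\<^esub> ?y" "s \<otimes>\<^bsub>R\<^esub> t" "s [^]\<^bsub>R\<^esub> q"]
          complement_mult complement_pow cl y by simp
      also have "\<dots> = r \<otimes>\<^bsub>RP\<^esub> \<phi> w i"
        unfolding r w phi[OF cl(3,4) i] using cl y by (intro rfraction_mult[symmetric]) auto
      finally show "\<phi> (r [^]\<^bsub>RP\<^esub> (p ^ e) \<odot>\<^bsub>MP\<^esub> w) i = r \<otimes>\<^bsub>RP\<^esub> \<phi> w i" . }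
  qed
  moreover have "\<phi> ` carrier MP = carrier (free_module RP n)"
  proof
    show "\<phi> ` carrier MP \<subseteq> carrier (free_module RP n)"
      using phi_in by (auto simp: free_module_simps)
    show "carrier (free_module RP n) \<subseteq> \<phi> ` carrier MP"
    proof
      fix w assume w: "w \<in> carrier (free_module RP n)"
      then have "w i \<in> carrier RP" if "i \<in> {..<n}" for i
        using that by (auto simp: free_module_simps)
      then obtain s where s: "s \<in> carrier R - P" "\<forall>i\<in>{..<n}. \<exists>a\<in>carrier R. w i = rfrac a s"
        using common_denominator[of "{..<n}" w] by blast
      then obtain a where a: "\<forall>i\<in>{..<n}. a i \<in> carrier R \<and> w i = rfrac (a i) s" by metis
      have "(\<lambda>i\<in>{..<n}. a i) \<in> carrier (free_module R n)" using a by (auto simp: free_module_simps)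
      then obtain x where x: "x \<in> carrier M" "f x = (\<lambda>i\<in>{..<n}. a i)" using surj by (metis imageE)
      have s': "s \<in> carrier R" "s [^]\<^bsub>R\<^esub> Suc q \<in> carrier R - P"
        using s(1) complement_pow[OF s(1), of "Suc q"] by (simp_all del: R.nat_pow_Suc)
      have "\<phi> (frac x (s [^]\<^bsub>R\<^esub> Suc q)) i = w i" if i: "i < n" for i
      proof -
        have "\<phi> (frac x (s [^]\<^bsub>R\<^esub> Suc q)) i = rfrac (f ((s [^]\<^bsub>R\<^esub> Suc q) [^]\<^bsub>R\<^esub> q \<odot>\<^bsub>M\<^esub> x) i) (s [^]\<^bsub>R\<^esub> Suc q)"
          using phi x s' i by blast
        also have "(s [^]\<^bsub>R\<^esub> Suc q) [^]\<^bsub>R\<^esub> q = (s [^]\<^bsub>R\<^esub> q) [^]\<^bsub>R\<^esub> Suc q"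
          using R.nat_pow_pow[OF s'(1), of "Suc q" q] R.nat_pow_pow[OF s'(1), of q "Suc q"]
          by (simp only: mult.commute)
        also have "f ((s [^]\<^bsub>R\<^esub> q) [^]\<^bsub>R\<^esub> Suc q \<odot>\<^bsub>M\<^esub> x) i = s [^]\<^bsub>R\<^esub> q \<otimes>\<^bsub>R\<^esub> a i"
          using fsm[of "s [^]\<^bsub>R\<^esub> q" x i] x s' i by simp
        also have "s [^]\<^bsub>R\<^esub> Suc q = s [^]\<^bsub>R\<^esub> q \<otimes>\<^bsub>R\<^esub> s" by simp
        also have "rfrac (s [^]\<^bsub>R\<^esub> q \<otimes>\<^bsub>R\<^esub> a i) (s [^]\<^bsub>R\<^esub> q \<otimes>\<^bsub>R\<^esub> s) = w i"
          using reg.fraction_cancel[of "a i" s "s [^]\<^bsub>R\<^esub> q"] a i s complement_pow[OF s(1)] by simp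
        finally show ?thesis by simp
      qed
      moreover have W: "frac x (s [^]\<^bsub>R\<^esub> Suc q) \<in> carrier MP" using x s' by (intro frac_in)
      ultimately have "\<phi> (frac x (s [^]\<^bsub>R\<^esub> Suc q)) = w"
        using w phi_in[OF W] by (intro PiE_ext[of _ "{..<n}" "\<lambda>_. carrier RP"]) (auto simp: free_module_simps)
      then show "w \<in> \<phi> ` carrier MP" using W by blast
    qed
  qed
  ultimately show ?thesis by blast
qed

text \<open>A preimage z/s of a basis vector is cleared of its denominator by acting with s: in the
  pushforward this gives s^q z/s = s^(q-1) z, an element that comes from M, and the basis vector
  becomes multiplied by s. The elements w j are these denominators.\<close>

lemma localized_surjection_restricts:
  assumes p: "p > 0"
    and phi: "\<phi> \<in> module_hom RP (frobenius_pushforward RP p e MP) (free_module RP n)"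
    and surj: "\<phi> ` carrier MP = carrier (free_module RP n)"
  obtains \<psi> x w where
    "\<And>i y. i < n \<Longrightarrow> y \<in> carrier M \<Longrightarrow> \<psi> i y \<in> carrier RP"
    "\<And>i y z. i < n \<Longrightarrow> y \<in> carrier M \<Longrightarrow> z \<in> carrier M \<Longrightarrow> \<psi> i (y \<oplus>\<^bsub>M\<^esub> z) = \<psi> i y \<oplus>\<^bsub>RP\<^esub> \<psi> i z"
    "\<And>i a y. i < n \<Longrightarrow> a \<in> carrier R \<Longrightarrow> y \<in> carrier M \<Longrightarrow>
       \<psi> i (a [^]\<^bsub>R\<^esub> (p ^ e) \<odot>\<^bsub>M\<^esub> y) = rfrac a \<one>\<^bsub>R\<^esub> \<otimes>\<^bsub>RP\<^esub> \<psi> i y"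
    "\<And>j. j < n \<Longrightarrow> x j \<in> carrier M"
    "\<And>j. j < n \<Longrightarrow> w j \<in> carrier R - P"
    "\<And>i j. i < n \<Longrightarrow> j < n \<Longrightarrow> \<psi> i (x j) = rfrac (if i = j then w j else \<zero>\<^bsub>R\<^esub>) \<one>\<^bsub>R\<^esub>"
proof -
  obtain q where q: "p ^ e = Suc q" using p by (metis gr0_implies_Suc zero_less_power)
  have hom_in: "\<phi> W i \<in> carrier RP" if "W \<in> carrier MP" "i < n" for W i
  proof -
    have "\<phi> W \<in> {..<n} \<rightarrow>\<^sub>E carrier RP" using phi that(1) unfolding localized_hom_iff by blast
    then show ?thesis using that(2) by (simp add: PiE_def Pi_def)
  qed
  have hom_add: "\<phi> (v \<oplus>\<^bsub>MP\<^esub> w) i = \<phi> v i \<oplus>\<^bsub>RP\<^esub> \<phi> w i"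
    if "v \<in> carrier MP" "w \<in> carrier MP" "i < n" for v w i
    using phi that unfolding localized_hom_iff by blast
  have hom_smult: "\<phi> ((r [^]\<^bsub>RP\<^esub> (p ^ e)) \<odot>\<^bsub>MP\<^esub> w) i = r \<otimes>\<^bsub>RP\<^esub> \<phi> w i"
    if "r \<in> carrier RP" "w \<in> carrier MP" "i < n" for r w i
    using phi that unfolding localized_hom_iff by blast
  define \<psi> where "\<psi> i y = \<phi> (frac y \<one>\<^bsub>R\<^esub>) i" for i y
  have one_in: "frac y \<one>\<^bsub>R\<^esub> \<in> carrier MP" if "y \<in> carrier M" for y
    using that complement_one by (intro frac_in)
  have 1: "\<psi> i y \<in> carrier RP" if "i < n" "y \<in> carrier M" for i y
    unfolding \<psi>_def by (rule hom_in[OF one_in[OF that(2)] that(1)])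
  have 2: "\<psi> i (y \<oplus>\<^bsub>M\<^esub> z) = \<psi> i y \<oplus>\<^bsub>RP\<^esub> \<psi> i z"
    if "i < n" "y \<in> carrier M" "z \<in> carrier M" for i y z
  proof -
    have "frac (y \<oplus>\<^bsub>M\<^esub> z) \<one>\<^bsub>R\<^esub> = frac y \<one>\<^bsub>R\<^esub> \<oplus>\<^bsub>MP\<^esub> frac z \<one>\<^bsub>R\<^esub>"
      using fraction_add[of y "\<one>\<^bsub>R\<^esub>" z "\<one>\<^bsub>R\<^esub>"] that complement_one by simp
    then show ?thesis using hom_add one_in that by (simp add: \<psi>_def)
  qed
  have scale: "rfrac a \<one>\<^bsub>R\<^esub> [^]\<^bsub>RP\<^esub> (p ^ e) \<odot>\<^bsub>MP\<^esub> frac y s = frac (a [^]\<^bsub>R\<^esub> (p ^ e) \<odot>\<^bsub>M\<^esub> y) s"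
    if "a \<in> carrier R" "y \<in> carrier M" "s \<in> carrier R - P" for a y s
    using that complement_one
    by (simp add: rfraction_pow[OF that(1) complement_one] fraction_smult)
  have 3: "\<psi> i (a [^]\<^bsub>R\<^esub> (p ^ e) \<odot>\<^bsub>M\<^esub> y) = rfrac a \<one>\<^bsub>R\<^esub> \<otimes>\<^bsub>RP\<^esub> \<psi> i y"
    if "i < n" "a \<in> carrier R" "y \<in> carrier M" for i a y
    unfolding \<psi>_def scale[OF that(2,3) complement_one, symmetric]
    by (rule hom_smult[OF rfrac_in[OF that(2) complement_one] one_in[OF that(3)] that(1)])
  have "\<exists>x w. x \<in> carrier M \<and> w \<in> carrier R - P \<and>
      (\<forall>i<n. \<psi> i x = rfrac (if i = j then w else \<zero>\<^bsub>R\<^esub>) \<one>\<^bsub>R\<^esub>)" if j: "j < n" for j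
  proof -
    let ?d = "\<lambda>i\<in>{..<n}. rfrac (if i = j then \<one>\<^bsub>R\<^esub> else \<zero>\<^bsub>R\<^esub>) \<one>\<^bsub>R\<^esub>"
    have "rfrac (if i = j then \<one>\<^bsub>R\<^esub> else \<zero>\<^bsub>R\<^esub>) \<one>\<^bsub>R\<^esub> \<in> carrier RP" for i
      by (intro rfrac_in complement_one) simp
    then have "?d \<in> carrier (free_module RP n)"
      by (simp only: free_module_simps restrict_PiE_iff ball_simps Ball_def simp_thms)
    then have "?d \<in> \<phi> ` carrier MP" by (simp only: surj)
    then obtain W where W: "W \<in> carrier MP" "\<phi> W = ?d" by (elim imageE) (rule that, assumption, rule sym)
    obtain z s where z: "W = frac z s" "z \<in> carrier M" "s \<in> carrier R - P"
      using W(1) unfolding carrier_MP by blast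
    have s: "s \<in> carrier R" "s [^]\<^bsub>R\<^esub> q \<odot>\<^bsub>M\<^esub> z \<in> carrier M" using z by auto
    have "rfrac s \<one>\<^bsub>R\<^esub> [^]\<^bsub>RP\<^esub> (p ^ e) \<odot>\<^bsub>MP\<^esub> W = frac (s [^]\<^bsub>R\<^esub> Suc q \<odot>\<^bsub>M\<^esub> z) s"
      using scale s z by (simp add: q del: R.nat_pow_Suc)
    also have "\<dots> = frac (s \<odot>\<^bsub>M\<^esub> (s [^]\<^bsub>R\<^esub> q \<odot>\<^bsub>M\<^esub> z)) (s \<otimes>\<^bsub>R\<^esub> \<one>\<^bsub>R\<^esub>)"
      using s z by (simp add: smult_assoc1[symmetric] R.m_comm)
    also have "\<dots> = frac (s [^]\<^bsub>R\<^esub> q \<odot>\<^bsub>M\<^esub> z) \<one>\<^bsub>R\<^esub>"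
      using fraction_cancel s z complement_one by blast
    finally have eq: "frac (s [^]\<^bsub>R\<^esub> q \<odot>\<^bsub>M\<^esub> z) \<one>\<^bsub>R\<^esub> = rfrac s \<one>\<^bsub>R\<^esub> [^]\<^bsub>RP\<^esub> (p ^ e) \<odot>\<^bsub>MP\<^esub> W" by simp
    have "\<psi> i (s [^]\<^bsub>R\<^esub> q \<odot>\<^bsub>M\<^esub> z) = rfrac (if i = j then s else \<zero>\<^bsub>R\<^esub>) \<one>\<^bsub>R\<^esub>" if i: "i < n" for i
    proof -
      have "\<psi> i (s [^]\<^bsub>R\<^esub> q \<odot>\<^bsub>M\<^esub> z) = rfrac s \<one>\<^bsub>R\<^esub> \<otimes>\<^bsub>RP\<^esub> \<phi> W i"
        unfolding \<psi>_def eq by (rule hom_smult[OF rfrac_in[OF s(1) complement_one] W(1) i])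
      also have "\<dots> = rfrac (s \<otimes>\<^bsub>R\<^esub> (if i = j then \<one>\<^bsub>R\<^esub> else \<zero>\<^bsub>R\<^esub>)) (\<one>\<^bsub>R\<^esub> \<otimes>\<^bsub>R\<^esub> \<one>\<^bsub>R\<^esub>)"
        using W i s complement_one by (simp add: rfraction_mult)
      finally show ?thesis using s by simp
    qed
    then show ?thesis using s z by blast
  qed
  then obtain x w where "\<forall>j<n. x j \<in> carrier M \<and> w j \<in> carrier R - P \<and>
      (\<forall>i<n. \<psi> i (x j) = rfrac (if i = j then w j else \<zero>\<^bsub>R\<^esub>) \<one>\<^bsub>R\<^esub>)" by metis
  then show ?thesis using 1 2 3 that[of \<psi> x w] by blast
qed

end

section \<open>Expanding fractions into homogeneous series\<close>

context graded_local_ring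
begin

lemma mm_subset: "mm \<subseteq> carrier R"
  using m0_subset piece_closed positive_part_component_0(1)
  unfolding mm_def set_add_def' by blast

text \<open>Being in the ideal is a condition on the degree-zero component alone, and taking this
  component is multiplicative.\<close>

lemma mm_primeideal: "primeideal mm R"
proof (rule primeidealI)
  have mm: "mm = {s \<in> carrier R. comp s 0 \<in> m0}" using mem_mm_iff mm_subset by blast
  show "ideal mm R"
  proof (rule idealI)
    show "ring R" by (rule ring_axioms)
    show "subgroup mm (add_monoid R)"
      unfolding mm using m0_zero
      by (intro add.subgroupI) (auto simp: component_add component_neg m0_add m0_neg simp flip: a_inv_def
          intro!: exI[of _ \<zero>])
    fix a x assume "a \<in> mm" "x \<in> carrier R"
    then have cl: "a \<in> carrier R" "comp a 0 \<in> m0" "x \<in> carrier R" unfolding mm by auto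
    then have "comp (x \<otimes> a) 0 \<in> m0" by (simp add: component_0_mult m0_mult component_in)
    then show "x \<otimes> a \<in> mm" "a \<otimes> x \<in> mm" using cl m_comm unfolding mm by auto
  qed
  show "cring R" by (rule is_cring)
  show "carrier R \<noteq> mm" using one_notin_mm one_closed by blast
  fix a b assume "a \<in> carrier R" "b \<in> carrier R" "a \<otimes> b \<in> mm"
  then show "a \<in> mm \<or> b \<in> mm" using mm_complement_mult[of a b] by blast
qed

lemma mm_localization: "module R M \<Longrightarrow> localization R M mm"
  using one_notin_mm mm_complement_mult
  by (intro localization.intro localization_axioms.intro) auto

abbreviation rfr where "rfr a s \<equiv> fraction R mm (regular_module R) a s"
abbreviation "Rm \<equiv> localized_ring R mm"

text \<open>The coefficient in degree n of a/s, expanded as a series of homogeneous elements. It is read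
  off from any element r of R that approximates a/s up to degree n, in the sense that s r and a
  have the same components there; \<open>expansion_eq\<close> shows that neither r nor the
  representation of the fraction matters.\<close>

definition expansion :: "nat \<Rightarrow> ('a \<times> 'a) set \<Rightarrow> 'a" where
  "expansion n Q = (THE c. \<exists>a s r. (a, s) \<in> Q \<and> r \<in> carrier R \<and> agree (Suc n) (s \<otimes> r) a \<and> c = comp r n)"

text \<open>Two approximations of the same fraction agree up to degree n after multiplication by a
  product of denominators, and these can be cancelled since they lie outside the maximal ideal.\<close>

lemma expansion_eq:
  assumes a: "a \<in> carrier R" and s: "s \<in> carrier R - mm" and r: "r \<in> carrier R"
    and agr: "agree (Suc n) (s \<otimes> r) a"
  shows "expansion n (rfr a s) = comp r n"
proof -
  interpret loc: localization R "regular_module R" mm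
    by (rule mm_localization[OF regular_module_is_module])
  show ?thesis unfolding expansion_def
  proof (rule the_equality)
    have "(a, s) \<in> rfr a s" using loc.fraction_self a s by simp
    then show "\<exists>a' s' r'. (a', s') \<in> rfr a s \<and> r' \<in> carrier R \<and> agree (Suc n) (s' \<otimes> r') a' \<and> comp r n = comp r' n"
      using r agr by blast
  next
    fix c assume "\<exists>a' s' r'. (a', s') \<in> rfr a s \<and> r' \<in> carrier R \<and> agree (Suc n) (s' \<otimes> r') a' \<and> c = comp r' n"
    then obtain b t r' where b: "(b, t) \<in> rfr a s" and r': "r' \<in> carrier R"
      and agr': "agree (Suc n) (t \<otimes> r') b" and c: "c = comp r' n" by blast
    note bt = loc.fraction_memD[OF b, simplified]
    obtain u where u: "u \<in> carrier R - mm" "u \<otimes> (t \<otimes> a) = u \<otimes> (s \<otimes> b)" using bt(3) by blast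
    have cl: "u \<in> carrier R" "t \<in> carrier R" "s \<in> carrier R" "b \<in> carrier R" using u bt s by auto
    have den: "u \<otimes> (s \<otimes> t) \<in> carrier R - mm"
      using mm_complement_mult u(1) s bt(2) by blast
    have "(u \<otimes> (s \<otimes> t)) \<otimes> r = (u \<otimes> t) \<otimes> (s \<otimes> r)" using cl r by (simp add: m_ac)
    moreover have "agree (Suc n) ((u \<otimes> t) \<otimes> (s \<otimes> r)) ((u \<otimes> t) \<otimes> a)"
      by (rule agree_mult[OF agree_refl agr]) (use cl in simp)
    moreover have "(u \<otimes> t) \<otimes> a = (u \<otimes> s) \<otimes> b" using cl a u(2) by (simp add: m_assoc)
    moreover have "agree (Suc n) ((u \<otimes> s) \<otimes> b) ((u \<otimes> s) \<otimes> (t \<otimes> r'))"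
      by (rule agree_mult[OF agree_refl agree_sym[OF agr']]) (use cl in simp)
    moreover have "(u \<otimes> s) \<otimes> (t \<otimes> r') = (u \<otimes> (s \<otimes> t)) \<otimes> r'" using cl r' by (simp add: m_ac)
    ultimately have "agree (Suc n) ((u \<otimes> (s \<otimes> t)) \<otimes> r) ((u \<otimes> (s \<otimes> t)) \<otimes> r')"
      using agree_trans by metis
    then have "agree (Suc n) r r'" by (rule agree_cancel[OF den _ r r'])
    then show "c = comp r n" using c agree_component by simp
  qed
qed

lemma fraction_approximation:
  assumes "Q \<in> carrier Rm"
  obtains a s r where "a \<in> carrier R" "s \<in> carrier R - mm" "r \<in> carrier R" "Q = rfr a s"
    "agree n (s \<otimes> r) a"
proof -
  interpret loc: localization R "regular_module R" mm
    by (rule mm_localization[OF regular_module_is_module])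
  obtain a s where Q: "a \<in> carrier R" "s \<in> carrier R - mm" "Q = rfr a s"
    using assms unfolding loc.carrier_RP by blast
  obtain t where t: "t \<in> carrier R" "agree n (s \<otimes> t) \<one>" using truncated_inverse[OF Q(2), of n] by blast
  have "agree n ((s \<otimes> t) \<otimes> a) (\<one> \<otimes> a)" by (rule agree_mult[OF t(2) agree_refl[OF Q(1)]])
  then have "agree n (s \<otimes> (t \<otimes> a)) a" using Q t by (simp add: m_assoc)
  then show ?thesis using that[of a s "t \<otimes> a"] Q t by simp
qed

lemma expansion_in:
  assumes "Q \<in> carrier Rm"
  shows "expansion n Q \<in> A n"
  using fraction_approximation[OF assms, of "Suc n"] expansion_eq component_in by metis

lemma expansion_of_ring:
  assumes "a \<in> carrier R"
  shows "expansion n (rfr a \<one>) = comp a n"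
  using expansion_eq[of a \<one> a n] assms one_notin_mm by (simp add: agree_refl)

lemma expansion_add:
  assumes "Q \<in> carrier Rm" "Q' \<in> carrier Rm"
  shows "expansion n (Q \<oplus>\<^bsub>Rm\<^esub> Q') = expansion n Q \<oplus> expansion n Q'"
proof -
  interpret loc: localization R "regular_module R" mm
    by (rule mm_localization[OF regular_module_is_module])
  obtain a s r where Q: "a \<in> carrier R" "s \<in> carrier R - mm" "r \<in> carrier R" "Q = rfr a s"
    "agree (Suc n) (s \<otimes> r) a" by (rule fraction_approximation[OF assms(1)])
  obtain b t r' where Q': "b \<in> carrier R" "t \<in> carrier R - mm" "r' \<in> carrier R" "Q' = rfr b t"
    "agree (Suc n) (t \<otimes> r') b" by (rule fraction_approximation[OF assms(2)])
  have cl: "s \<in> carrier R" "t \<in> carrier R" using Q Q' by auto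
  have "agree (Suc n) (t \<otimes> (s \<otimes> r) \<oplus> s \<otimes> (t \<otimes> r')) (t \<otimes> a \<oplus> s \<otimes> b)"
    by (intro agree_add agree_mult[OF agree_refl] Q(5) Q'(5) cl)
  moreover have "t \<otimes> (s \<otimes> r) \<oplus> s \<otimes> (t \<otimes> r') = (s \<otimes> t) \<otimes> (r \<oplus> r')"
    using cl Q Q' by (simp add: r_distr m_ac)
  ultimately have agr: "agree (Suc n) ((s \<otimes> t) \<otimes> (r \<oplus> r')) (t \<otimes> a \<oplus> s \<otimes> b)" by simp
  have "expansion n (Q \<oplus>\<^bsub>Rm\<^esub> Q') = expansion n (rfr (t \<otimes> a \<oplus> s \<otimes> b) (s \<otimes> t))"
    unfolding Q(4) Q'(4) by (simp add: loc.rfraction_add[OF Q(1,2) Q'(1,2)])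
  also have "\<dots> = comp (r \<oplus> r') n"
    by (rule expansion_eq[OF _ mm_complement_mult[OF Q(2) Q'(2)] _ agr]) (use Q Q' cl in auto)
  also have "\<dots> = expansion n Q \<oplus> expansion n Q'"
    unfolding Q(4) Q'(4) expansion_eq[OF Q(1-3,5)] expansion_eq[OF Q'(1-3,5)]
    using Q Q' by (simp add: component_add)
  finally show ?thesis .
qed

lemma expansion_homogeneous_mult:
  assumes "Q \<in> carrier Rm" "c \<in> A i"
  shows "expansion n (rfr c \<one> \<otimes>\<^bsub>Rm\<^esub> Q) = (if i \<le> n then c \<otimes> expansion (n - i) Q else \<zero>)"
proof -
  interpret loc: localization R "regular_module R" mm
    by (rule mm_localization[OF regular_module_is_module])
  obtain a s r where Q: "a \<in> carrier R" "s \<in> carrier R - mm" "r \<in> carrier R" "Q = rfr a s"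
    and agr: "agree (Suc n) (s \<otimes> r) a" by (rule fraction_approximation[OF assms(1)])
  have cl: "s \<in> carrier R" "c \<in> carrier R" using Q assms piece_closed by auto
  have "agree (Suc n) (c \<otimes> (s \<otimes> r)) (c \<otimes> a)"
    by (rule agree_mult[OF agree_refl[OF cl(2)] agr])
  moreover have "c \<otimes> (s \<otimes> r) = s \<otimes> (c \<otimes> r)" using cl Q by (simp add: m_ac)
  ultimately have agr': "agree (Suc n) (s \<otimes> (c \<otimes> r)) (c \<otimes> a)" by simp
  have "expansion n (rfr c \<one> \<otimes>\<^bsub>Rm\<^esub> Q) = expansion n (rfr (c \<otimes> a) s)"
    unfolding Q(4) using loc.rfraction_mult[OF cl(2) _ Q(1,2), of \<one>] one_notin_mm cl by simp
  also have "\<dots> = comp (c \<otimes> r) n"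
    by (rule expansion_eq[OF _ Q(2) _ agr']) (use Q cl in auto)
  also have "\<dots> = (if i \<le> n then c \<otimes> comp r (n - i) else \<zero>)"
    by (rule component_homogeneous_mult[OF assms(2) Q(3)])
  also have "comp r (n - i) = expansion (n - i) Q"
    unfolding Q(4) by (rule expansion_eq[OF Q(1-3), symmetric]) (use agr in \<open>auto simp: agree_def\<close>)
  finally show ?thesis .
qed

end

section \<open>Functionals on the Frobenius pushforward of a graded module\<close>

text \<open>The Frobenius pushforward of a graded module: q stands for a power of the characteristic,
  and a in R acts on M as multiplication by a^q. This action is linear in a because the q-th power
  map is additive, and it multiplies degrees in R by q.\<close>

locale frobenius_graded_module = R?: graded_local_ring R A m0 + M?: module R M
  for R :: "('a, 'r) ring_scheme" (structure) and A m0
    and M :: "('a, 'b, 'm) module_scheme" (structure) +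
  fixes B :: "int \<Rightarrow> 'b set" and q :: nat
  assumes module_direct_sum: "internal_direct_sum M B"
    and piece_smult: "a \<in> A i \<Longrightarrow> x \<in> B j \<Longrightarrow> a \<odot>\<^bsub>M\<^esub> x \<in> B (int i + j)"
    and q_pos: "q > 0"
    and power_add: "a \<in> carrier R \<Longrightarrow> b \<in> carrier R \<Longrightarrow> (a \<oplus>\<^bsub>R\<^esub> b) [^]\<^bsub>R\<^esub> q = a [^]\<^bsub>R\<^esub> q \<oplus>\<^bsub>R\<^esub> b [^]\<^bsub>R\<^esub> q"

sublocale frobenius_graded_module \<subseteq> MG: graded_group M B
  by unfold_locales (rule module_direct_sum)

context frobenius_graded_module
begin

abbreviation act where "act a x \<equiv> a [^]\<^bsub>R\<^esub> q \<odot>\<^bsub>M\<^esub> x"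

lemma act_closed: "a \<in> carrier R \<Longrightarrow> x \<in> carrier M \<Longrightarrow> act a x \<in> carrier M"
  by simp

lemma act_l_distr:
  "a \<in> carrier R \<Longrightarrow> b \<in> carrier R \<Longrightarrow> x \<in> carrier M \<Longrightarrow> act (a \<oplus>\<^bsub>R\<^esub> b) x = act a x \<oplus>\<^bsub>M\<^esub> act b x"
  by (simp add: power_add smult_l_distr)

lemma act_mult:
  "a \<in> carrier R \<Longrightarrow> b \<in> carrier R \<Longrightarrow> x \<in> carrier M \<Longrightarrow> act (a \<otimes>\<^bsub>R\<^esub> b) x = act a (act b x)"
  by (simp add: R.nat_pow_distrib smult_assoc1)

lemma act_one: "x \<in> carrier M \<Longrightarrow> act \<one>\<^bsub>R\<^esub> x = x"
  by simp

lemma act_zero: "x \<in> carrier M \<Longrightarrow> act \<zero>\<^bsub>R\<^esub> x = \<zero>\<^bsub>M\<^esub>"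
  using q_pos by (simp add: R.nat_pow_zero)

lemma act_sum:
  assumes "a \<in> carrier R" "\<And>i. i \<in> I \<Longrightarrow> g i \<in> carrier M"
  shows "act a (finsum M g I) = finsum M (\<lambda>i. act a (g i)) I"
  using assms by (intro M.finsum_hom M.abelian_monoid_axioms)
    (auto simp: hom_def smult_r_distr)

lemma act_minus:
  assumes "a \<in> carrier R" "x \<in> carrier M" "y \<in> carrier M"
  shows "act a (x \<ominus>\<^bsub>M\<^esub> y) = act a x \<ominus>\<^bsub>M\<^esub> act a y"
  using assms by (simp add: a_minus_def smult_r_distr smult_r_minus)

lemma power_piece: "a \<in> A i \<Longrightarrow> a [^]\<^bsub>R\<^esub> (n::nat) \<in> A (n * i)"
proof (induction n)
  case 0
  then show ?case using one_in_piece by simp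
next
  case (Suc n)
  then show ?case using piece_mult[of "a [^]\<^bsub>R\<^esub> n" "n * i" a i] by (simp add: add.commute)
qed

lemma component_smult:
  assumes "a \<in> A i" "x \<in> carrier M"
  shows "MG.comp (a \<odot>\<^bsub>M\<^esub> x) d = a \<odot>\<^bsub>M\<^esub> MG.comp x (d - int i)"
  using assms(2)
proof (induction rule: MG.homogeneous_induct)
  case zero
  then show ?case using assms piece_closed by simp
next
  case (homogeneous j y)
  then show ?case
    using assms piece_closed MG.component_homogeneous[OF piece_smult[OF assms(1) homogeneous]]
      MG.component_homogeneous[OF homogeneous] by auto
next
  case (add y z)
  then show ?case using assms(1) piece_closed
    by (simp add: smult_r_distr MG.component_add)
qed

lemma component_act:
  assumes "a \<in> A i" "x \<in> carrier M"
  shows "MG.comp (act a x) d = act a (MG.comp x (d - int (q * i)))"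
  using component_smult[OF power_piece[OF assms(1)] assms(2)] .

text \<open>Linear maps from the Frobenius pushforward of M to R.\<close>

definition functional :: "('b \<Rightarrow> 'a) \<Rightarrow> bool" where
  "functional f \<longleftrightarrow> f \<in> carrier M \<rightarrow> carrier R \<and>
    (\<forall>x\<in>carrier M. \<forall>y\<in>carrier M. f (x \<oplus>\<^bsub>M\<^esub> y) = f x \<oplus>\<^bsub>R\<^esub> f y) \<and>
    (\<forall>a\<in>carrier R. \<forall>x\<in>carrier M. f (act a x) = a \<otimes>\<^bsub>R\<^esub> f x)"

text \<open>Linear maps from the Frobenius pushforward of M to the product of the homogeneous pieces of
  R, where T n is the coordinate in degree n. Functionals with values in the localization of R are
  of this kind through the expansion of fractions.\<close>

definition formal_functional :: "(nat \<Rightarrow> 'b \<Rightarrow> 'a) \<Rightarrow> bool" where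
  "formal_functional T \<longleftrightarrow> (\<forall>n. \<forall>x\<in>carrier M. T n x \<in> A n) \<and>
    (\<forall>n. \<forall>x\<in>carrier M. \<forall>y\<in>carrier M. T n (x \<oplus>\<^bsub>M\<^esub> y) = T n x \<oplus>\<^bsub>R\<^esub> T n y) \<and>
    (\<forall>i n. \<forall>a\<in>A i. \<forall>x\<in>carrier M.
      T n (act a x) = (if i \<le> n then a \<otimes>\<^bsub>R\<^esub> T (n - i) x else \<zero>\<^bsub>R\<^esub>))"

lemma functional_closed: "functional f \<Longrightarrow> x \<in> carrier M \<Longrightarrow> f x \<in> carrier R"
  and functional_add: "functional f \<Longrightarrow> x \<in> carrier M \<Longrightarrow> y \<in> carrier M \<Longrightarrow> f (x \<oplus>\<^bsub>M\<^esub> y) = f x \<oplus>\<^bsub>R\<^esub> f y"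
  and functional_act: "functional f \<Longrightarrow> a \<in> carrier R \<Longrightarrow> x \<in> carrier M \<Longrightarrow> f (act a x) = a \<otimes>\<^bsub>R\<^esub> f x"
  by (auto simp: functional_def)

lemma functional_zero: "functional f \<Longrightarrow> f \<zero>\<^bsub>M\<^esub> = \<zero>\<^bsub>R\<^esub>"
  using functional_act[of f "\<zero>\<^bsub>R\<^esub>" "\<zero>\<^bsub>M\<^esub>"] functional_closed[of f "\<zero>\<^bsub>M\<^esub>"] act_zero[of "\<zero>\<^bsub>M\<^esub>"] by simp

lemma functional_sum:
  assumes "functional f" "\<And>j. j \<in> J \<Longrightarrow> c j \<in> carrier R" "\<And>j. j \<in> J \<Longrightarrow> x j \<in> carrier M"
  shows "f (finsum M (\<lambda>j. act (c j) (x j)) J) = (\<Oplus>\<^bsub>R\<^esub>j\<in>J. c j \<otimes>\<^bsub>R\<^esub> f (x j))"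
proof -
  have "f (finsum M (\<lambda>j. act (c j) (x j)) J) = (\<Oplus>\<^bsub>R\<^esub>j\<in>J. f (act (c j) (x j)))"
    using assms by (intro M.finsum_hom R.abelian_monoid_axioms)
      (auto simp: hom_def functional_add functional_closed functional_zero)
  also have "\<dots> = (\<Oplus>\<^bsub>R\<^esub>j\<in>J. c j \<otimes>\<^bsub>R\<^esub> f (x j))"
    using assms by (intro R.finsum_cong') (auto simp: functional_act functional_closed)
  finally show ?thesis .
qed

lemma functional_combination:
  assumes "functional f" "functional g" "a \<in> carrier R"
  shows "functional (\<lambda>x. f x \<ominus>\<^bsub>R\<^esub> a \<otimes>\<^bsub>R\<^esub> g x)"
  unfolding functional_def
proof (intro conjI ballI)
  show "(\<lambda>x. f x \<ominus>\<^bsub>R\<^esub> a \<otimes>\<^bsub>R\<^esub> g x) \<in> carrier M \<rightarrow> carrier R"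
    using assms functional_closed by auto
  fix x assume x: "x \<in> carrier M"
  note cl = functional_closed[OF assms(1) x] functional_closed[OF assms(2) x]
  { fix y assume y: "y \<in> carrier M"
    show "f (x \<oplus>\<^bsub>M\<^esub> y) \<ominus>\<^bsub>R\<^esub> a \<otimes>\<^bsub>R\<^esub> g (x \<oplus>\<^bsub>M\<^esub> y) = (f x \<ominus>\<^bsub>R\<^esub> a \<otimes>\<^bsub>R\<^esub> g x) \<oplus>\<^bsub>R\<^esub> (f y \<ominus>\<^bsub>R\<^esub> a \<otimes>\<^bsub>R\<^esub> g y)"
      using cl functional_closed[OF assms(1) y] functional_closed[OF assms(2) y] x y assms(3)
      by (simp add: functional_add[OF assms(1)] functional_add[OF assms(2)] R.r_distr
          a_minus_def R.minus_add R.a_ac) }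
  { fix b assume b: "b \<in> carrier R"
    show "f (act b x) \<ominus>\<^bsub>R\<^esub> a \<otimes>\<^bsub>R\<^esub> g (act b x) = b \<otimes>\<^bsub>R\<^esub> (f x \<ominus>\<^bsub>R\<^esub> a \<otimes>\<^bsub>R\<^esub> g x)"
      using cl x b assms(3)
      by (simp add: functional_act[OF assms(1)] functional_act[OF assms(2)] R.r_distr
          a_minus_def R.r_minus R.m_lcomm) }
qed

lemma functional_scale:
  assumes "functional f" "a \<in> carrier R"
  shows "functional (\<lambda>x. a \<otimes>\<^bsub>R\<^esub> f x)"
  using assms unfolding functional_def by (auto simp: Pi_def R.r_distr R.m_lcomm)

lemma formal_in: "formal_functional T \<Longrightarrow> x \<in> carrier M \<Longrightarrow> T n x \<in> A n"
  and formal_add: "formal_functional T \<Longrightarrow> x \<in> carrier M \<Longrightarrow> y \<in> carrier M \<Longrightarrow> T n (x \<oplus>\<^bsub>M\<^esub> y) = T n x \<oplus>\<^bsub>R\<^esub> T n y"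
  and formal_act: "formal_functional T \<Longrightarrow> a \<in> A i \<Longrightarrow> x \<in> carrier M \<Longrightarrow>
    T n (act a x) = (if i \<le> n then a \<otimes>\<^bsub>R\<^esub> T (n - i) x else \<zero>\<^bsub>R\<^esub>)"
  by (auto simp: formal_functional_def)

lemma formal_closed: "formal_functional T \<Longrightarrow> x \<in> carrier M \<Longrightarrow> T n x \<in> carrier R"
  using formal_in piece_closed by blast

lemma formal_zero: "formal_functional T \<Longrightarrow> T n \<zero>\<^bsub>M\<^esub> = \<zero>\<^bsub>R\<^esub>"
  using formal_act[of T "\<zero>\<^bsub>R\<^esub>" 0 "\<zero>\<^bsub>M\<^esub>" n] formal_closed[of T "\<zero>\<^bsub>M\<^esub>" n] piece_zero act_zero[of "\<zero>\<^bsub>M\<^esub>"] by simp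

lemma formal_minus:
  assumes "formal_functional T" "x \<in> carrier M" "y \<in> carrier M"
  shows "T n (x \<ominus>\<^bsub>M\<^esub> y) = T n x \<ominus>\<^bsub>R\<^esub> T n y"
proof -
  have "T n (x \<ominus>\<^bsub>M\<^esub> y) \<oplus>\<^bsub>R\<^esub> T n y = T n ((x \<ominus>\<^bsub>M\<^esub> y) \<oplus>\<^bsub>M\<^esub> y)"
    using assms by (intro formal_add[symmetric]) auto
  also have "(x \<ominus>\<^bsub>M\<^esub> y) \<oplus>\<^bsub>M\<^esub> y = x" using assms by (simp add: a_minus_def M.a_assoc M.l_neg)
  finally have eq: "T n x = T n (x \<ominus>\<^bsub>M\<^esub> y) \<oplus>\<^bsub>R\<^esub> T n y" by simp
  show ?thesis unfolding eq
    using assms formal_closed[of T "x \<ominus>\<^bsub>M\<^esub> y" n] formal_closed[of T y n] by (simp add: a_minus_def R.a_assoc R.r_neg)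
qed

lemma formal_0_act:
  assumes T: "formal_functional T" and "a \<in> carrier R" and x: "x \<in> carrier M"
  shows "T 0 (act a x) = comp a 0 \<otimes>\<^bsub>R\<^esub> T 0 x"
  using assms(2)
proof (induction rule: homogeneous_induct)
  case zero
  then show ?case using act_zero[OF x] formal_zero[OF T] formal_closed[OF T x] by simp
next
  case (homogeneous i a)
  then show ?case
    using formal_act[OF T homogeneous x, of 0] formal_closed[OF T x, of 0] component_homogeneous[OF homogeneous, of 0]
    by auto
next
  case (add a b)
  then show ?case
    using act_l_distr[OF add(1,2) x] formal_add[OF T act_closed[OF add(1) x] act_closed[OF add(2) x], of 0]
      formal_closed[OF T x, of 0] by (simp add: component_add R.l_distr)
qed

lemma formal_0_sum:
  assumes "formal_functional T" "\<And>j. j \<in> J \<Longrightarrow> c j \<in> carrier R" "\<And>j. j \<in> J \<Longrightarrow> x j \<in> carrier M"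
  shows "T 0 (finsum M (\<lambda>j. act (c j) (x j)) J) = (\<Oplus>\<^bsub>R\<^esub>j\<in>J. comp (c j) 0 \<otimes>\<^bsub>R\<^esub> T 0 (x j))"
proof -
  have "T 0 (finsum M (\<lambda>j. act (c j) (x j)) J) = (\<Oplus>\<^bsub>R\<^esub>j\<in>J. T 0 (act (c j) (x j)))"
    using assms by (intro M.finsum_hom R.abelian_monoid_axioms)
      (auto simp: hom_def formal_add formal_closed formal_zero)
  also have "\<dots> = (\<Oplus>\<^bsub>R\<^esub>j\<in>J. comp (c j) 0 \<otimes>\<^bsub>R\<^esub> T 0 (x j))"
    using assms by (intro R.finsum_cong') (auto simp: formal_0_act formal_closed)
  finally show ?thesis .
qed

lemma formal_functional_compose:
  assumes T: "formal_functional T"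
    and h: "h \<in> carrier M \<rightarrow> carrier M"
      "\<And>x y. x \<in> carrier M \<Longrightarrow> y \<in> carrier M \<Longrightarrow> h (x \<oplus>\<^bsub>M\<^esub> y) = h x \<oplus>\<^bsub>M\<^esub> h y"
      "\<And>a x. a \<in> carrier R \<Longrightarrow> x \<in> carrier M \<Longrightarrow> h (act a x) = act a (h x)"
  shows "formal_functional (\<lambda>n x. T n (h x))"
proof -
  have hx: "h x \<in> carrier M" if "x \<in> carrier M" for x using h(1) that by blast
  show ?thesis
    unfolding formal_functional_def
    using formal_in[OF T hx] formal_add[OF T hx hx] formal_act[OF T _ hx] h(2,3) piece_closed by simp
qed

text \<open>The part of T that sends degree d + q n of M to degree n of R. It takes values in R because
  an element of M has only finitely many nonzero components, and it is linear because a
  homogeneous scalar of degree i shifts degrees in M by q i and degrees in R by i. Degrees of M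
  outside d + q \<nat> are sent to 0.\<close>

lemma functional_of_formal:
  assumes T: "formal_functional T"
  obtains f where "functional f"
    "\<And>x n. x \<in> carrier M \<Longrightarrow> comp (f x) n = T n (MG.comp x (d + int (q * n)))"
proof -
  have "\<exists>r\<in>carrier R. \<forall>n. comp r n = T n (MG.comp x (d + int (q * n)))" if x: "x \<in> carrier M" for x
  proof -
    let ?t = "\<lambda>n. T n (MG.comp x (d + int (q * n)))"
    let ?I = "{n. MG.comp x (d + int (q * n)) \<noteq> \<zero>\<^bsub>M\<^esub>}"
    have "inj_on (\<lambda>n. d + int (q * n)) ?I" using q_pos by (auto simp: inj_on_def)
    moreover have "(\<lambda>n. d + int (q * n)) ` ?I \<subseteq> {i. MG.comp x i \<noteq> \<zero>\<^bsub>M\<^esub>}" by auto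
    ultimately have fin: "finite ?I" using inj_on_finite MG.finite_support[OF x] by blast
    have eq: "comp (finsum R ?t ?I) = ?t"
      by (rule component_unique[OF fin]) (auto simp: formal_in[OF T] formal_zero[OF T] x)
    have cl: "finsum R ?t ?I \<in> carrier R"
      by (intro R.finsum_closed) (auto simp: formal_closed[OF T] x)
    show ?thesis by (rule bexI[OF _ cl], rule allI, rule fun_cong[OF eq])
  qed
  then obtain f where "\<forall>x\<in>carrier M. f x \<in> carrier R \<and>
      (\<forall>n. comp (f x) n = T n (MG.comp x (d + int (q * n))))"
    using bchoice[of "carrier M" "\<lambda>x r. r \<in> carrier R \<and>
      (\<forall>n. comp r n = T n (MG.comp x (d + int (q * n))))"] by blast
  then have f: "\<And>x. x \<in> carrier M \<Longrightarrow> f x \<in> carrier R"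
    "\<And>x n. x \<in> carrier M \<Longrightarrow> comp (f x) n = T n (MG.comp x (d + int (q * n)))" by blast+
  have f_add: "f (x \<oplus>\<^bsub>M\<^esub> y) = f x \<oplus>\<^bsub>R\<^esub> f y" if "x \<in> carrier M" "y \<in> carrier M" for x y
    by (rule component_ext) (use that in \<open>auto simp: f component_add MG.component_add formal_add[OF T]\<close>)
  have f_act: "f (act a x) = a \<otimes>\<^bsub>R\<^esub> f x" if a: "a \<in> carrier R" and x: "x \<in> carrier M" for a x
    using a
  proof (induction rule: homogeneous_induct)
    case zero
    have "f \<zero>\<^bsub>M\<^esub> = \<zero>\<^bsub>R\<^esub>"
      by (rule component_ext) (auto simp: f formal_zero[OF T])
    then show ?case using act_zero[OF x] f(1)[OF x] by simp
  next
    case (homogeneous i a)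
    have a: "a \<in> carrier R" using homogeneous piece_closed by blast
    show ?case
    proof (rule component_ext)
      fix n
      have "comp (f (act a x)) n = T n (MG.comp (act a x) (d + int (q * n)))"
        using f(2)[OF act_closed[OF a x]] .
      also have "\<dots> = T n (act a (MG.comp x (d + int (q * n) - int (q * i))))"
        by (simp only: component_act[OF homogeneous x])
      also have "\<dots> = (if i \<le> n then a \<otimes>\<^bsub>R\<^esub> T (n - i) (MG.comp x (d + int (q * n) - int (q * i))) else \<zero>\<^bsub>R\<^esub>)"
        by (rule formal_act[OF T homogeneous MG.component_closed[OF x]])
      also have "\<dots> = (if i \<le> n then a \<otimes>\<^bsub>R\<^esub> comp (f x) (n - i) else \<zero>\<^bsub>R\<^esub>)"
        by (simp add: f(2)[OF x] diff_mult_distrib2 of_nat_diff add_diff_eq)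
      also have "\<dots> = comp (a \<otimes>\<^bsub>R\<^esub> f x) n"
        by (rule component_homogeneous_mult[OF homogeneous f(1)[OF x], symmetric])
      finally show "comp (f (act a x)) n = comp (a \<otimes>\<^bsub>R\<^esub> f x) n" .
    qed (use a x f(1) in auto)
  next
    case (add a b)
    have "f (act (a \<oplus>\<^bsub>R\<^esub> b) x) = f (act a x) \<oplus>\<^bsub>R\<^esub> f (act b x)"
      unfolding act_l_distr[OF add(1,2) x] by (intro f_add act_closed add x)
    then show ?case using add f(1)[OF x] by (simp add: R.l_distr)
  qed
  have "functional f" unfolding functional_def using f(1) f_add f_act by blast
  then show ?thesis using that f(2) by blast
qed

text \<open>Fewer than n conditions cannot force a combination X of the n elements x j to vanish modulo
  the maximal ideal, so X can be chosen with all f k X in that ideal and some T i not vanishing on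
  X modulo m0. Composing T i with the projection that kills the y l, and passing to the part that
  is homogeneous with respect to a suitable component of X, gives the next functional.\<close>

lemma dual_system_extend:
  fixes r n :: nat
  assumes f: "\<And>k. k < r \<Longrightarrow> functional (f k)"
    and y: "\<And>k. k < r \<Longrightarrow> y k \<in> B (d k)"
    and dual: "\<And>k l. k < r \<Longrightarrow> l < r \<Longrightarrow> f k (y l) = (if k = l then \<one>\<^bsub>R\<^esub> else \<zero>\<^bsub>R\<^esub>)"
    and T: "\<And>i. i < n \<Longrightarrow> formal_functional (T i)"
    and x: "\<And>j. j < n \<Longrightarrow> x j \<in> carrier M"
    and w: "\<And>j. j < n \<Longrightarrow> w j \<in> A 0 - m0"
    and diag: "\<And>i j. i < n \<Longrightarrow> j < n \<Longrightarrow> T i 0 (x j) = (if i = j then w j else \<zero>\<^bsub>R\<^esub>)"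
    and "r < n"
  obtains g z c where "functional g" "z \<in> B c" "g z = \<one>\<^bsub>R\<^esub>" "\<And>l. l < r \<Longrightarrow> g (y l) = \<zero>\<^bsub>R\<^esub>"
proof -
  have yc: "y k \<in> carrier M" if "k < r" for k using y MG.piece_closed that by blast
  have wc: "w j \<in> carrier R" if "j < n" for j using w[OF that] piece_closed by blast
  have m0_of_mm: "comp a 0 \<in> m0" if "a \<in> mm" for a using that mem_mm_iff mm_subset by blast
  \<comment> \<open>The r conditions that f k takes a value in the maximal ideal on a combination of the n
    elements x j have a nontrivial solution c.\<close>
  have "\<exists>c. (\<forall>j\<in>{..<n}. c j \<in> carrier R) \<and> (\<exists>j\<in>{..<n}. c j \<notin> mm) \<and>
      (\<forall>k\<in>{..<r}. (\<Oplus>\<^bsub>R\<^esub>j\<in>{..<n}. c j \<otimes>\<^bsub>R\<^esub> f k (x j)) \<in> mm)"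
    using \<open>r < n\<close> by (intro R.prime_ideal_kernel_vector mm_primeideal) (auto intro: functional_closed f x)
  then obtain c i where c: "\<And>j. j < n \<Longrightarrow> c j \<in> carrier R" and i: "i < n" "c i \<notin> mm"
    and ker: "\<And>k. k < r \<Longrightarrow> (\<Oplus>\<^bsub>R\<^esub>j\<in>{..<n}. c j \<otimes>\<^bsub>R\<^esub> f k (x j)) \<in> mm" by blast
  note Ti = T[OF i(1)]
  define X where "X = finsum M (\<lambda>j. act (c j) (x j)) {..<n}"
  have X: "X \<in> carrier M" unfolding X_def using c x by (intro M.finsum_closed) auto
  have fX: "f k X \<in> mm" if "k < r" for k
    unfolding X_def using functional_sum[OF f[OF that], of "{..<n}" c x] ker[OF that] c x by simp
  have "T i 0 X = (\<Oplus>\<^bsub>R\<^esub>j\<in>{..<n}. comp (c j) 0 \<otimes>\<^bsub>R\<^esub> T i 0 (x j))"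
    unfolding X_def using c x by (intro formal_0_sum[OF Ti]) auto
  also have "\<dots> = (\<Oplus>\<^bsub>R\<^esub>j\<in>{..<n}. if i = j then comp (c j) 0 \<otimes>\<^bsub>R\<^esub> w j else \<zero>\<^bsub>R\<^esub>)"
    using c wc i by (intro R.finsum_cong') (auto simp: diag)
  also have "\<dots> = comp (c i) 0 \<otimes>\<^bsub>R\<^esub> w i"
    using i c wc by (intro R.finsum_singleton) auto
  finally have "T i 0 X = comp (c i) 0 \<otimes>\<^bsub>R\<^esub> w i" .
  moreover have "comp (c i) 0 \<otimes>\<^bsub>R\<^esub> w i \<notin> m0"
    using m0_primeD[OF component_in[OF c[OF i(1)], of 0], of "w i"] w[OF i(1)] i mem_mm_iff[OF c[OF i(1)]] by blast
  ultimately have TX: "T i 0 X \<notin> m0" by simp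
  \<comment> \<open>The projection h subtracts from v its part along the y k. On X that part has coefficients f
    k X in the maximal ideal, so T i 0 is unchanged on X modulo m0.\<close>
  define s where "s v = finsum M (\<lambda>k. act (f k v) (y k)) {..<r}" for v
  define h where "h v = v \<ominus>\<^bsub>M\<^esub> s v" for v
  have s: "s v \<in> carrier M" if "v \<in> carrier M" for v
    unfolding s_def using that f yc functional_closed by (intro M.finsum_closed) auto
  have h: "h v \<in> carrier M" if "v \<in> carrier M" for v unfolding h_def using s that by simp
  have term_closed: "act (f k v) (y k) \<in> carrier M" if "k < r" "v \<in> carrier M" for k v
    using that f functional_closed yc act_closed by blast
  have s_add: "s (u \<oplus>\<^bsub>M\<^esub> v) = s u \<oplus>\<^bsub>M\<^esub> s v" if "u \<in> carrier M" "v \<in> carrier M" for u v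
  proof -
    have "s (u \<oplus>\<^bsub>M\<^esub> v) = finsum M (\<lambda>k. act (f k u) (y k) \<oplus>\<^bsub>M\<^esub> act (f k v) (y k)) {..<r}"
      unfolding s_def
    proof (rule M.finsum_cong')
      fix k assume "k \<in> {..<r}"
      then have k: "k < r" by simp
      show "act (f k (u \<oplus>\<^bsub>M\<^esub> v)) (y k) = act (f k u) (y k) \<oplus>\<^bsub>M\<^esub> act (f k v) (y k)"
        unfolding functional_add[OF f[OF k] that]
        by (intro act_l_distr functional_closed f k that yc)
    qed (use term_closed that in auto)
    also have "\<dots> = s u \<oplus>\<^bsub>M\<^esub> s v"
      unfolding s_def using term_closed that by (intro M.finsum_addf) auto
    finally show ?thesis .
  qed
  have s_act: "s (act a v) = act a (s v)" if "a \<in> carrier R" "v \<in> carrier M" for a v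
  proof -
    have "s (act a v) = finsum M (\<lambda>k. act a (act (f k v) (y k))) {..<r}"
      unfolding s_def
    proof (rule M.finsum_cong')
      fix k assume "k \<in> {..<r}"
      then have k: "k < r" by simp
      show "act (f k (act a v)) (y k) = act a (act (f k v) (y k))"
        unfolding functional_act[OF f[OF k] that]
        by (intro act_mult functional_closed f k that yc)
    qed (use term_closed that in auto)
    also have "\<dots> = act a (s v)"
      unfolding s_def using term_closed that by (intro act_sum[symmetric]) auto
    finally show ?thesis .
  qed
  have h_y: "h (y l) = \<zero>\<^bsub>M\<^esub>" if l: "l < r" for l
  proof -
    have "s (y l) = finsum M (\<lambda>k. if l = k then y k else \<zero>\<^bsub>M\<^esub>) {..<r}"
      unfolding s_def
    proof (rule M.finsum_cong')
      fix k assume "k \<in> {..<r}"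
      then show "act (f k (y l)) (y k) = (if l = k then y k else \<zero>\<^bsub>M\<^esub>)"
        using dual[of k l] l act_one[OF yc] act_zero[OF yc] by auto
    qed (use yc in auto)
    also have "\<dots> = y l" using l yc by (intro M.finsum_singleton) auto
    finally show ?thesis using yc[OF l] by (simp add: h_def a_minus_def M.r_neg)
  qed
  define H where "H m v = T i m (h v)" for m v
  have H: "formal_functional H"
    unfolding H_def
  proof (rule formal_functional_compose[OF Ti])
    show "h \<in> carrier M \<rightarrow> carrier M" using h by blast
    show "h (u \<oplus>\<^bsub>M\<^esub> v) = h u \<oplus>\<^bsub>M\<^esub> h v" if "u \<in> carrier M" "v \<in> carrier M" for u v
      unfolding h_def s_add[OF that] using that s
      by (simp add: a_minus_def M.minus_add M.a_ac)
    show "h (act a v) = act a (h v)" if "a \<in> carrier R" "v \<in> carrier M" for a v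
      unfolding h_def s_act[OF that] using that s by (intro act_minus[symmetric])
  qed
  have H_y: "H m (y l) = \<zero>\<^bsub>R\<^esub>" if "l < r" for m l
    unfolding H_def h_y[OF that] by (rule formal_zero[OF Ti])
  have "H 0 X = T i 0 X \<ominus>\<^bsub>R\<^esub> T i 0 (s X)"
    unfolding H_def h_def by (rule formal_minus[OF Ti X s[OF X]])
  moreover have "T i 0 (s X) \<in> m0"
  proof -
    have "T i 0 (s X) = (\<Oplus>\<^bsub>R\<^esub>k\<in>{..<r}. comp (f k X) 0 \<otimes>\<^bsub>R\<^esub> T i 0 (y k))"
      unfolding s_def using functional_closed[OF f X] yc by (intro formal_0_sum[OF Ti]) auto
    also have "\<dots> \<in> m0"
    proof (rule R.finsum_in_submonoid)
      fix k assume "k \<in> {..<r}"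
      then have "k < r" by simp
      then have "T i 0 (y k) \<otimes>\<^bsub>R\<^esub> comp (f k X) 0 \<in> m0"
        using m0_mult[OF formal_in[OF Ti yc]] m0_of_mm fX by blast
      then show "comp (f k X) 0 \<otimes>\<^bsub>R\<^esub> T i 0 (y k) \<in> m0"
        using R.m_comm functional_closed[OF f X] formal_closed[OF Ti yc] \<open>k < r\<close> component_closed by metis
    qed (use m0_zero m0_subset piece_closed m0_add in auto)
    finally show ?thesis .
  qed
  ultimately have HX: "H 0 X \<notin> m0"
  proof -
    assume eq: "H 0 X = T i 0 X \<ominus>\<^bsub>R\<^esub> T i 0 (s X)" and sX: "T i 0 (s X) \<in> m0"
    have cl: "T i 0 X \<in> carrier R" "T i 0 (s X) \<in> carrier R" using formal_closed[OF Ti] X s by auto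
    have "T i 0 X = H 0 X \<oplus>\<^bsub>R\<^esub> T i 0 (s X)"
      unfolding eq using cl by (simp add: a_minus_def R.a_assoc R.l_neg)
    then show ?thesis using TX m0_add sX by metis
  qed
  have "\<exists>c. H 0 (MG.comp X c) \<notin> m0"
    by (rule MG.exists_component_outside[OF X, where P = "\<lambda>v. H 0 v \<in> m0"])
      (use HX m0_zero m0_add formal_zero[OF H] formal_add[OF H] in auto)
  then obtain c' where c': "H 0 (MG.comp X c') \<notin> m0" by blast
  \<comment> \<open>The coefficient u of the composed map on the component z is a unit of degree zero, so the
    homogeneous part g that sends the degree of z to degree 0 satisfies g z = u.\<close>
  define z where "z = MG.comp X c'"
  have z: "z \<in> B c'" "z \<in> carrier M" unfolding z_def using MG.component_in[OF X] MG.component_closed[OF X] by auto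
  define u where "u = H 0 z"
  have u: "u \<in> A 0" "u \<notin> m0" "u \<in> carrier R"
    unfolding u_def using formal_in[OF H z(2)] c' piece_closed by (auto simp: z_def)
  obtain v where v: "v \<in> A 0" "u \<otimes>\<^bsub>R\<^esub> v = \<one>\<^bsub>R\<^esub>" using piece_unit[OF u(1,2)] by blast
  have vc: "v \<in> carrier R" using v piece_closed by blast
  obtain g where g: "functional g"
    "\<And>x n. x \<in> carrier M \<Longrightarrow> comp (g x) n = H n (MG.comp x (c' + int (q * n)))"
    by (rule functional_of_formal[OF H, of c']) blast
  have "g z = u"
  proof (rule component_ext)
    fix m
    show "comp (g z) m = comp u m"
      using q_pos formal_zero[OF H]
      by (cases "m = 0") (auto simp: g(2)[OF z(2)] MG.component_homogeneous[OF z(1)]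
          component_homogeneous[OF u(1)] u_def[symmetric])
  qed (use functional_closed[OF g(1) z(2)] u in auto)
  then have 1: "v \<otimes>\<^bsub>R\<^esub> g z = \<one>\<^bsub>R\<^esub>" using v vc u R.m_comm by simp
  have 2: "v \<otimes>\<^bsub>R\<^esub> g (y l) = \<zero>\<^bsub>R\<^esub>" if l: "l < r" for l
  proof -
    have "g (y l) = \<zero>\<^bsub>R\<^esub>"
    proof (rule component_ext)
      fix m
      show "comp (g (y l)) m = comp \<zero>\<^bsub>R\<^esub> m"
        using formal_zero[OF H] H_y[OF l]
        by (auto simp: g(2)[OF yc[OF l]] MG.component_homogeneous[OF y[OF l]])
    qed (use functional_closed[OF g(1) yc[OF l]] in auto)
    then show ?thesis using vc by simp
  qed
  show ?thesis
    by (rule that[OF functional_scale[OF g(1) vc] z(1) 1 2])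
qed

text \<open>A new pair g, z is added to the system by correcting each f k by the multiple f k z of g.
  This makes f k vanish on z and leaves its values on the y l unchanged, because g vanishes there.
  The f k need not be homogeneous; the extension step uses homogeneity of the y l alone.\<close>

lemma homogeneous_dual_system:
  fixes r n :: nat
  assumes T: "\<And>i. i < n \<Longrightarrow> formal_functional (T i)"
    and x: "\<And>j. j < n \<Longrightarrow> x j \<in> carrier M"
    and w: "\<And>j. j < n \<Longrightarrow> w j \<in> A 0 - m0"
    and diag: "\<And>i j. i < n \<Longrightarrow> j < n \<Longrightarrow> T i 0 (x j) = (if i = j then w j else \<zero>\<^bsub>R\<^esub>)"
    and "r \<le> n"
  shows "\<exists>f y d. (\<forall>k<r. functional (f k)) \<and> (\<forall>k<r. y k \<in> B (d k)) \<and>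
    (\<forall>k<r. \<forall>l<r. f k (y l) = (if k = l then \<one>\<^bsub>R\<^esub> else \<zero>\<^bsub>R\<^esub>))"
  using \<open>r \<le> n\<close>
proof (induction r)
  case 0
  then show ?case by simp
next
  case (Suc r)
  then obtain f y d where f: "\<forall>k<r. functional (f k)" and y: "\<forall>k<r. y k \<in> B (d k)"
    and dual: "\<forall>k<r. \<forall>l<r. f k (y l) = (if k = l then \<one>\<^bsub>R\<^esub> else \<zero>\<^bsub>R\<^esub>)" by auto
  have "r < n" using Suc.prems by simp
  obtain g z c where g: "functional g" "z \<in> B c" "g z = \<one>\<^bsub>R\<^esub>" "\<And>l. l < r \<Longrightarrow> g (y l) = \<zero>\<^bsub>R\<^esub>"
    by (rule dual_system_extend[of r f y d n T x w]) (use f y dual T x w diag \<open>r < n\<close> in auto)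
  have z: "z \<in> carrier M" using g(2) MG.piece_closed by blast
  have yc: "y k \<in> carrier M" if "k < r" for k using y MG.piece_closed that by blast
  define f' where "f' k = (if k < r then (\<lambda>v. f k v \<ominus>\<^bsub>R\<^esub> f k z \<otimes>\<^bsub>R\<^esub> g v) else g)" for k
  define y' where "y' = y(r := z)"
  define d' where "d' = d(r := c)"
  have "functional (f' k)" if "k < Suc r" for k
    using f g(1) functional_combination functional_closed z by (auto simp: f'_def)
  moreover have "y' k \<in> B (d' k)" if "k < Suc r" for k
    using that y g(2) by (auto simp: y'_def d'_def)
  moreover have "f' k (y' l) = (if k = l then \<one>\<^bsub>R\<^esub> else \<zero>\<^bsub>R\<^esub>)" if k: "k < Suc r" and l: "l < Suc r" for k l
  proof (cases "k < r")
    case True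
    have fz: "f k z \<in> carrier R" using functional_closed f True z by blast
    show ?thesis
    proof (cases "l < r")
      case l: True
      then have "f' k (y' l) = f k (y l) \<ominus>\<^bsub>R\<^esub> f k z \<otimes>\<^bsub>R\<^esub> \<zero>\<^bsub>R\<^esub>"
        using True g(4) by (simp add: f'_def y'_def)
      also have "\<dots> = f k (y l)"
        using fz functional_closed[of "f k" "y l"] f True yc l by (simp add: a_minus_def)
      finally show ?thesis using dual True l by simp
    next
      case False
      then have "l = r" using l by simp
      then show ?thesis using True fz g(3) by (simp add: f'_def y'_def a_minus_def R.r_neg)
    qed
  next
    case False
    then have "k = r" using k by simp
    then show ?thesis using l g(3,4) by (auto simp: f'_def y'_def less_Suc_eq)
  qed
  ultimately show ?case by blast
qed

lemma surjection_of_dual_system: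
  assumes f: "\<And>k. k < n \<Longrightarrow> functional (f k)" and y: "\<And>k. k < n \<Longrightarrow> y k \<in> carrier M"
    and dual: "\<And>k l. k < n \<Longrightarrow> l < n \<Longrightarrow> f k (y l) = (if k = l then \<one>\<^bsub>R\<^esub> else \<zero>\<^bsub>R\<^esub>)"
    and q: "q = p ^ e"
  shows "\<exists>F\<in>module_hom R (frobenius_pushforward R p e M) (free_module R n).
    F ` carrier M = carrier (free_module R n)"
proof -
  define F where "F v = (\<lambda>k\<in>{..<n}. f k v)" for v
  have F_in: "F v \<in> {..<n} \<rightarrow>\<^sub>E carrier R" if "v \<in> carrier M" for v
    unfolding F_def restrict_PiE_iff using f functional_closed that by blast
  have "F \<in> module_hom R (frobenius_pushforward R p e M) (free_module R n)"
  proof (subst frobenius_hom_free_iff)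
    show "F \<in> carrier M \<rightarrow> ({..<n} \<rightarrow>\<^sub>E carrier R) \<and>
      (\<forall>i<n. (\<forall>x\<in>carrier M. \<forall>y\<in>carrier M. F (x \<oplus>\<^bsub>M\<^esub> y) i = F x i \<oplus>\<^bsub>R\<^esub> F y i) \<and>
        (\<forall>a\<in>carrier R. \<forall>x\<in>carrier M. F ((a [^]\<^bsub>R\<^esub> (p ^ e)) \<odot>\<^bsub>M\<^esub> x) i = a \<otimes>\<^bsub>R\<^esub> F x i))"
      using F_in functional_add[OF f] functional_act[OF f] unfolding q[symmetric] by (auto simp: F_def)
  qed auto
  moreover have "F ` carrier M = carrier (free_module R n)"
  proof
    show "F ` carrier M \<subseteq> carrier (free_module R n)" using F_in by (auto simp: free_module_simps)
    show "carrier (free_module R n) \<subseteq> F ` carrier M"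
    proof
      fix a assume "a \<in> carrier (free_module R n)"
      then have a: "a \<in> {..<n} \<rightarrow>\<^sub>E carrier R" by (simp add: free_module_simps)
      then have ac: "a j \<in> carrier R" if "j < n" for j using that by auto
      define X where "X = finsum M (\<lambda>j. act (a j) (y j)) {..<n}"
      have X: "X \<in> carrier M" unfolding X_def using ac y by (intro M.finsum_closed) auto
      have "f k X = a k" if k: "k < n" for k
      proof -
        have "f k X = (\<Oplus>\<^bsub>R\<^esub>j\<in>{..<n}. a j \<otimes>\<^bsub>R\<^esub> f k (y j))"
          unfolding X_def using ac y by (intro functional_sum[OF f[OF k]]) auto
        also have "\<dots> = (\<Oplus>\<^bsub>R\<^esub>j\<in>{..<n}. if k = j then a j else \<zero>\<^bsub>R\<^esub>)"
          using ac k by (intro R.finsum_cong') (auto simp: dual)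
        also have "\<dots> = a k" using ac k by (intro R.finsum_singleton) auto
        finally show ?thesis .
      qed
      then have "F X = a"
        using F_in[OF X] a by (intro PiE_ext[of _ "{..<n}" "\<lambda>_. carrier R"]) (auto simp: F_def)
      then show "a \<in> F ` carrier M" using X by blast
    qed
  qed
  ultimately show ?thesis by blast
qed

text \<open>The coordinates of a surjection over the localization, restricted to M and expanded into
  series, are formal functionals that satisfy the hypotheses of
  \<open>homogeneous_dual_system\<close>.\<close>

lemma localized_surjection_descends:
  assumes q: "q = p ^ e" and p: "p > 0"
    and phi: "\<phi> \<in> module_hom Rm (frobenius_pushforward Rm p e (localized_module R mm M)) (free_module Rm n)"
    and surj: "\<phi> ` carrier (localized_module R mm M) = carrier (free_module Rm n)"
  shows "\<exists>F\<in>module_hom R (frobenius_pushforward R p e M) (free_module R n).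
    F ` carrier M = carrier (free_module R n)"
proof -
  interpret loc: localization R M mm by (rule mm_localization) (rule M.module_axioms)
  obtain \<psi> x w where psi:
    "\<And>i y. i < n \<Longrightarrow> y \<in> carrier M \<Longrightarrow> \<psi> i y \<in> carrier Rm"
    "\<And>i y z. i < n \<Longrightarrow> y \<in> carrier M \<Longrightarrow> z \<in> carrier M \<Longrightarrow> \<psi> i (y \<oplus>\<^bsub>M\<^esub> z) = \<psi> i y \<oplus>\<^bsub>Rm\<^esub> \<psi> i z"
    "\<And>i a y. i < n \<Longrightarrow> a \<in> carrier R \<Longrightarrow> y \<in> carrier M \<Longrightarrow>
       \<psi> i (act a y) = rfr a \<one>\<^bsub>R\<^esub> \<otimes>\<^bsub>Rm\<^esub> \<psi> i y"
    and x: "\<And>j. j < n \<Longrightarrow> x j \<in> carrier M"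
    and w: "\<And>j. j < n \<Longrightarrow> w j \<in> carrier R - mm"
    and diag: "\<And>i j. i < n \<Longrightarrow> j < n \<Longrightarrow> \<psi> i (x j) = rfr (if i = j then w j else \<zero>\<^bsub>R\<^esub>) \<one>\<^bsub>R\<^esub>"
    by (rule loc.localized_surjection_restricts[OF p phi surj, folded q]) (rule that; assumption)
  define T where "T i m v = expansion m (\<psi> i v)" for i m v
  have T: "formal_functional (T i)" if i: "i < n" for i
    unfolding formal_functional_def T_def
  proof (intro conjI allI ballI)
    fix m v assume v: "v \<in> carrier M"
    show "expansion m (\<psi> i v) \<in> A m" by (rule expansion_in[OF psi(1)[OF i v]])
    { fix v' assume v': "v' \<in> carrier M"
      show "expansion m (\<psi> i (v \<oplus>\<^bsub>M\<^esub> v')) = expansion m (\<psi> i v) \<oplus>\<^bsub>R\<^esub> expansion m (\<psi> i v')"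
        unfolding psi(2)[OF i v v'] by (rule expansion_add[OF psi(1)[OF i v] psi(1)[OF i v']]) }
    { fix l a assume a: "a \<in> A l"
      show "expansion m (\<psi> i (act a v)) = (if l \<le> m then a \<otimes>\<^bsub>R\<^esub> expansion (m - l) (\<psi> i v) else \<zero>\<^bsub>R\<^esub>)"
        unfolding psi(3)[OF i piece_closed[OF a] v]
        by (rule expansion_homogeneous_mult[OF psi(1)[OF i v] a]) }
  qed
  have w0: "comp (w j) 0 \<in> A 0 - m0" if "j < n" for j
    using w[OF that] mem_mm_iff component_in by blast
  have T0: "T i 0 (x j) = (if i = j then comp (w j) 0 else \<zero>\<^bsub>R\<^esub>)" if "i < n" "j < n" for i j
    unfolding T_def diag[OF that] using w[OF that(2)] by (simp add: expansion_of_ring)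
  obtain f y d where f: "\<forall>k<n. functional (f k)" and y: "\<forall>k<n. y k \<in> B (d k)"
    and dual: "\<forall>k<n. \<forall>l<n. f k (y l) = (if k = l then \<one>\<^bsub>R\<^esub> else \<zero>\<^bsub>R\<^esub>)"
    using homogeneous_dual_system[of n T x "\<lambda>j. comp (w j) 0" n, OF T x w0 T0] by blast
  show ?thesis
    by (rule surjection_of_dual_system[of n f y, OF _ _ _ q]) (use f y dual MG.piece_closed in auto)
qed

lemma frobenius_frk_localization:
  assumes "q = p ^ e" "p > 0"
  shows "frobenius_frk R p M e = frobenius_frk Rm p (localized_module R mm M) e"
proof -
  interpret loc: localization R M mm by (rule mm_localization) (rule M.module_axioms)
  have "(\<exists>f\<in>module_hom R (frobenius_pushforward R p e M) (free_module R n). f ` carrier M = carrier (free_module R n))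
    \<longleftrightarrow> (\<exists>f\<in>module_hom Rm (frobenius_pushforward Rm p e (localized_module R mm M)) (free_module Rm n).
      f ` carrier (localized_module R mm M) = carrier (free_module Rm n))" for n
    using localized_surjection_descends[OF assms] loc.frobenius_surjection_localizes[OF assms(2)] by blast
  then show ?thesis by (simp add: frobenius_frk_def frk_def)
qed

end

section \<open>Comparison of the invariants\<close>

theorem proposition6p18:
  fixes R :: "('a, 'r) ring_scheme"
    and \<A> :: "nat \<Rightarrow> 'a set"
    and R\<^sub>0 :: "('a, 'r) ring_scheme"
    and \<mm>\<^sub>0 \<mm> :: "'a set"
    and p :: nat
    and M :: "('a, 'b, 'm) module_scheme"
    and \<M> :: "int \<Rightarrow> 'b set"
  assumes graded: "positively_graded_ring R \<A>"
    and noetherian: "noetherian_ring R"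
    and R0: "R\<^sub>0 = R\<lparr>carrier := \<A> 0\<rparr>"
    and local_R0: "noetherian_local_ring R\<^sub>0 \<mm>\<^sub>0"
    and p: "Factorial_Ring.prime p" "has_characteristic R\<^sub>0 p"
    and F_finite_R0: "F_finite R\<^sub>0 p"
    and finite_type: "finite_type_over R (carrier R\<^sub>0)"
    and m: "\<mm> = \<mm>\<^sub>0 <+>\<^bsub>R\<^esub> positive_part R \<A>"
    and graded_M: "graded_module R \<A> M \<M>"
    and fg_M: "fg_module R M"
  shows "(\<forall>e>0. frobenius_frk R p M e
              = frobenius_frk (localized_ring R \<mm>) p (localized_module R \<mm> M) e)
    \<and> splitting_dimension R p M
        = splitting_dimension (localized_ring R \<mm>) p (localized_module R \<mm> M)
    \<and> F_splitting_ratio R p M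
        = F_splitting_ratio (localized_ring R \<mm>) p (localized_module R \<mm> M)"
proof -
  interpret R: cring R using graded by (simp add: positively_graded_ring_def)
  interpret M: module R M using graded_M by (simp add: graded_module_def)
  interpret L: graded_local_ring R \<A> \<mm>\<^sub>0
    using graded local_R0 unfolding R0 positively_graded_ring_def
    by unfold_locales auto
  have "[p] \<cdot>\<^bsub>R\<^sub>0\<^esub> \<one>\<^bsub>R\<^sub>0\<^esub> = \<zero>\<^bsub>R\<^sub>0\<^esub>" using p(2) by (simp add: has_characteristic_def)
  then have char: "[p] \<cdot>\<^bsub>R\<^esub> \<one>\<^bsub>R\<^esub> = \<zero>\<^bsub>R\<^esub>" by (simp add: R0 add_pow_def nat_pow_def)
  have p_pos: "p > 0" using p(1) prime_gt_0_nat by blast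
  have frk: "frobenius_frk R p M e = frobenius_frk (localized_ring R \<mm>) p (localized_module R \<mm> M) e" for e
  proof -
    interpret F: frobenius_graded_module R \<A> \<mm>\<^sub>0 M \<M> "p ^ e"
    proof unfold_locales
      show "internal_direct_sum M \<M>" using graded_M by (simp add: graded_module_def)
      show "a \<odot>\<^bsub>M\<^esub> x \<in> \<M> (int i + j)" if "a \<in> \<A> i" "x \<in> \<M> j" for a i x j
        using graded_M that by (simp add: graded_module_def)
      show "0 < p ^ e" using p_pos by simp
      show "(a \<oplus>\<^bsub>R\<^esub> b) [^]\<^bsub>R\<^esub> (p ^ e) = a [^]\<^bsub>R\<^esub> (p ^ e) \<oplus>\<^bsub>R\<^esub> b [^]\<^bsub>R\<^esub> (p ^ e)"
        if "a \<in> carrier R" "b \<in> carrier R" for a b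
        by (rule R.frobenius_power_add[OF p(1) char that])
    qed
    show ?thesis using F.frobenius_frk_localization[OF refl p_pos] unfolding m L.mm_def .
  qed
  then have eq: "frobenius_frk R p M = frobenius_frk (localized_ring R \<mm>) p (localized_module R \<mm> M)"
    by (rule ext)
  show ?thesis
    unfolding splitting_dimension_def F_splitting_ratio_def eq by simp
qed

end
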